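(* Let $\mathfrak{F}\subseteq\mathfrak{F}_{\mathrm{all}}$ satisfy $\mathfrak{F}\supseteq\mathfrak{F}_{\mathrm{AR}(2)}^{ext}$ and suppose that the polynomial trend assumption holds: $X=(F,\tilde X)$, where $F$ is $n\times k_F$-dimensional ($1\le k_F\le k$) with $j$-th column $(1^{j-1},\ldots,n^{j-1})'$, where $\tilde X$ is an $n\times(k-k_F)$-dimensional matrix such that $X$ has rank $k$ ($\tilde X$ is the empty matrix if $k_F=k$), and the restriction matrix $R$ has a nonzero column $R_{\cdot i}$ for some $i\in\{1,\ldots,k_F\}$. Suppose further that the real $n\times n$ matrix $\mathcal{W}$ is constant (does not depend on $y\in\mathbb{R}^n$) and symmetric, and that $\Pi_{\mathrm{span}(X)^\perp}\mathcal{W}\Pi_{\mathrm{span}(X)^\perp}$ is nonzero. Let $\check\Omega_{\mathcal{W}}(y)=\hat\omega_{\mathcal{W}}(y)R(X'X)^{-1}R'$ with $\hat\omega_{\mathcal{W}}(y)=n^{-1}\hat u'(y)\mathcal{W}\hat u(y)$. Then $\check\beta=\hat\beta$ and $\check\Omega=\check\Omega_{\mathcal{W}}$ satisfy the estimator conditions with $N=\emptyset$. Let $T$ be the nonsphericity-corrected F-type test statistic with $\check\beta=\hat\beta$, $\check\Omega=\check\Omega_{\mathcal{W}}$, and $N=\emptyset$. Then $$P_{0,I_n}(\hat\omega_{\mathcal{W}}\ge0)\le\sup_{f\in\mathfrak{F}}P_{\mu_0,\sigma^2\Sigma(f)}(T\ge C)$$ holds for every critical value $C$, $-\infty<C<\infty$,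 for every $\mu_0\in\mathfrak{M}_0$, and for every $\sigma^2\in(0,\infty)$. Furthermore, for every $0\le C<\infty$, $$\sup_{\mu_1\in\mathfrak{M}_1}\sup_{0<\sigma^2<\infty}P_{\mu_1,\sigma^2I_n}(T\ge C)\le P_{0,I_n}(\hat\omega_{\mathcal{W}}\ge0).$$
   Context: Model: $n,k,q$ are positive integers with $1\le k<n$; $X\in\mathbb{R}^{n\times k}$ is a fixed matrix of rank $k$; $R\in\mathbb{R}^{q\times k}$ has rank $q\ge 1$; $r\in\mathbb{R}^q$. (One tests $R\beta=r$ against $R\beta\neq r$ in $\mathbf{Y}=X\beta+\mathbf{U}$, $\mathbf{U}\sim N(0,\sigma^2\Sigma(f))$, $0<\sigma^2<\infty$, $f\in\mathfrak{F}$.) $'$ is transpose, $\mathrm{span}(\cdot)$ is column space, $\Pi_{\mathcal{L}}$ is orthogonal projection onto $\mathcal{L}$, $\mathfrak{M}_0=\{X\beta:R\beta=r\}$, $\mathfrak{M}_1=\{X\beta:R\beta\ne r\}$, $\hat\beta(y)=(X'X)^{-1}X'y$, $\hat u(y)=y-X\hat\beta(y)$. $P_{\mu,A}$ is the Gaussian measure on $\mathbb{R}^n$ with mean $\mu$ and covariance $A$; $P(T\ge C)$ means $P(\{y:T(y)\ge C\})$, similarly $P(\hat\omega_{\mathcal{W}}\ge0)$. $\lambda_{\mathbb{R}^n}$ is Lebesgue measure. Spectral densities: $\mathfrak{F}_{\mathrm{all}}$ is the set of all normalized spectral densities of real weakly stationary processes (nonnegative, even, integrable $f$ on $[-\pi,\pi]$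 with $\int_{-\pi}^{\pi}f=1$); $\mathfrak{F}_{\mathrm{AR}(2)}$ is the subset of those corresponding to stationary autoregressive processes of order at most two; $\mathfrak{F}_{\mathrm{AR}(2)}^{ext}$ is the set of all $c_1f+(2\pi)^{-1}c_2$ with $f\in\mathfrak{F}_{\mathrm{AR}(2)}$, $c_1,c_2\ge0$, $c_1+c_2=1$; $\Sigma(f)=\left[\int_{-\pi}^{\pi}e^{-\iota(j-l)\omega}f(\omega)d\omega\right]_{j,l=1}^n$, $\iota$ the imaginary unit. Estimator conditions on $(\check\beta,\check\Omega,N)$: (i) $\check\beta:\mathbb{R}^n\setminus N\to\mathbb{R}^k$ and $\check\Omega:\mathbb{R}^n\setminus N\to\mathbb{R}^{q\times q}$ are well-defined and continuous on $\mathbb{R}^n\setminus N$, where $N$ is a closed $\lambda_{\mathbb{R}^n}$-null set, and $\check\Omega(y)$ is symmetric for every $y\in\mathbb{R}^n\setminus N$; (ii) $y\in\mathbb{R}^n\setminus N$ implies $\delta y+X\eta\in\mathbb{R}^n\setminus N$ for all $\delta\ne0$, $\eta\in\mathbb{R}^k$; (iii) $\check\beta(\delta y+X\eta)=\delta\check\beta(y)+\eta$ and $\check\Omega(\delta y+X\eta)=\delta^2\check\Omega(y)$ for all $y\in\mathbb{R}^n\setminus N$, $\delta\neq0$, $\eta\in\mathbb{R}^k$; (iv) $\check\Omega$ is $\lambda_{\mathbb{R}^n}$-almost everywhere nonsingular on $\mathbb{R}^n\setminus N$. Nonsphericity-corrected F-type test statistic: with $N^*=N\cup\{y\in\mathbb{R}^n\setminus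 N:\det\check\Omega(y)=0\}$, $T(y)=(R\check\beta(y)-r)'\check\Omega^{-1}(y)(R\check\beta(y)-r)$ for $y\in\mathbb{R}^n\setminus N^*$ and $T(y)=0$ for $y\in N^*$. *)

theory Defs
  imports "HOL-Probability.Probability"
begin

text \<open>
  Vectors and matrices of size \<open>n\<close>, \<open>k\<close>, \<open>q\<close> are indexed by finite types \<open>'n\<close>, \<open>'k\<close>, \<open>'q\<close>.  Where the
  numerical value of an index matters (time \<open>1, \<dots>, n\<close>, column number \<open>1, \<dots>, k\<close>), an arbitrary
  bijection of the index type with \<open>{1..CARD(_)}\<close> is passed explicitly.
\<close>

section \<open>Spectral densities\<close>

text \<open>
  Functions on \<open>[-\<pi>, \<pi>]\<close> are extensional, i.e.\ they have a fixed dummy value outside the interval, so that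
  the sets below are in bijection with the corresponding sets of functions defined on \<open>[-\<pi>, \<pi>]\<close> only.
\<close>

definition F_all :: "(real \<Rightarrow> real) set" where
  "F_all = {f \<in> {-pi..pi} \<rightarrow>\<^sub>E {0..}.
      (\<forall>\<omega>\<in>{-pi..pi}. f (-\<omega>) = f \<omega>) \<and>
      set_integrable lebesgue {-pi..pi} f \<and>
      (LINT \<omega>:{-pi..pi}|lebesgue. f \<omega>) = 1}"

text \<open>
  The spectral density of the stationary solution of \<open>x\<^sub>t = a\<^sub>1 x\<^sub>t\<^sub>-\<^sub>1 + a\<^sub>2 x\<^sub>t\<^sub>-\<^sub>2 + \<epsilon>\<^sub>t\<close>, with white noise \<open>\<epsilon>\<close> of
  variance \<open>s\<close>; \<open>s\<close> is determined by the normalization.  Requiring merely that the autoregressive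
  polynomial has no zero on the unit circle would give the same set, since reflecting a zero in the
  circle changes the density only by a constant factor.
\<close>

definition F_AR2 :: "(real \<Rightarrow> real) set" where
  "F_AR2 = {f \<in> F_all. \<exists>a1 a2 s :: real. s > 0 \<and>
      (\<forall>z :: complex. cmod z \<le> 1 \<longrightarrow> 1 - of_real a1 * z - of_real a2 * z\<^sup>2 \<noteq> 0) \<and>
      (\<forall>\<omega>\<in>{-pi..pi}. f \<omega> = s / (2 * pi) /
         (cmod (1 - of_real a1 * exp (- \<i> * of_real \<omega>) - of_real a2 * exp (- 2 * \<i> * of_real \<omega>)))\<^sup>2)}"

definition F_AR2_ext :: "(real \<Rightarrow> real) set" where
  "F_AR2_ext = {(\<lambda>\<omega>\<in>{-pi..pi}. c1 * f \<omega> + c2 / (2 * pi)) | f c1 c2.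
      f \<in> F_AR2 \<and> c1 \<ge> 0 \<and> c2 \<ge> 0 \<and> c1 + c2 = 1}"

text \<open>
  The integral is real because \<open>f\<close> is even; \<^const>\<open>Re\<close> only turns it into an element of type \<^typ>\<open>real\<close>.
  Here \<open>t i\<close> is the time point belonging to index \<open>i\<close>.
\<close>

definition Sigma_spec :: "('n \<Rightarrow> nat) \<Rightarrow> (real \<Rightarrow> real) \<Rightarrow> real^'n^'n" where
  "Sigma_spec t f = (\<chi> j l. Re (LINT \<omega>:{-pi..pi}|lebesgue.
      exp (- \<i> * (of_nat (t j) - of_nat (t l)) * of_real \<omega>) * of_real (f \<omega>)))"

section \<open>Gaussian measures\<close>

text \<open>
  The definition by a density is meaningful for positive definite \<open>A\<close> only.  This covers all covariance
  matrices considered: see \<open>Sigma_spec_pos_def\<close> below.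
\<close>

definition gaussian :: "real^'n \<Rightarrow> real^'n^'n \<Rightarrow> (real^'n) measure" where
  "gaussian \<mu> A = density lborel (\<lambda>y. ennreal
      (exp (- ((y - \<mu>) \<bullet> (matrix_inv A *v (y - \<mu>))) / 2) / sqrt ((2 * pi) ^ CARD('n) * det A)))"

section \<open>The linear model and the test statistic\<close>

definition M0 :: "real^'k^'n \<Rightarrow> real^'k^'q \<Rightarrow> real^'q \<Rightarrow> (real^'n) set" where
  "M0 X R r = {X *v \<beta> | \<beta>. R *v \<beta> = r}"

definition M1 :: "real^'k^'n \<Rightarrow> real^'k^'q \<Rightarrow> real^'q \<Rightarrow> (real^'n) set" where
  "M1 X R r = {X *v \<beta> | \<beta>. R *v \<beta> \<noteq> r}"

definition proj_matrix :: "(real^'n) set \<Rightarrow> real^'n^'n" where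
  "proj_matrix L = matrix (\<lambda>y. THE p. p \<in> L \<and> y - p \<in> L\<^sup>\<bottom>)"

definition beta_hat :: "real^'k^'n \<Rightarrow> real^'n \<Rightarrow> real^'k" where
  "beta_hat X y = matrix_inv (transpose X ** X) *v (transpose X *v y)"

definition u_hat :: "real^'k^'n \<Rightarrow> real^'n \<Rightarrow> real^'n" where
  "u_hat X y = y - X *v beta_hat X y"

definition omega_hat :: "real^'k^'n \<Rightarrow> real^'n^'n \<Rightarrow> real^'n \<Rightarrow> real" where
  "omega_hat X W y = (u_hat X y \<bullet> (W *v u_hat X y)) / real CARD('n)"

definition Omega_W :: "real^'k^'n \<Rightarrow> real^'k^'q \<Rightarrow> real^'n^'n \<Rightarrow> real^'n \<Rightarrow> real^'q^'q" where
  "Omega_W X R W y =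
     omega_hat X W y *\<^sub>R (R ** matrix_inv (transpose X ** X) ** transpose R)"

text \<open>Estimators are total functions here; nothing is required of their values on \<open>N\<close>.\<close>

definition estimator_conditions ::
  "real^'k^'n \<Rightarrow> (real^'n \<Rightarrow> real^'k) \<Rightarrow> (real^'n \<Rightarrow> real^'q^'q) \<Rightarrow> (real^'n) set \<Rightarrow> bool" where
  "estimator_conditions X b Om N \<longleftrightarrow>
     closed N \<and> N \<in> null_sets lborel \<and>
     continuous_on (- N) b \<and> continuous_on (- N) Om \<and>
     (\<forall>y. y \<notin> N \<longrightarrow> transpose (Om y) = Om y) \<and>
     (\<forall>y \<delta> \<eta>. y \<notin> N \<longrightarrow> \<delta> \<noteq> 0 \<longrightarrow> \<delta> *\<^sub>R y + X *v \<eta> \<notin> N) \<and>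
     (\<forall>y \<delta> \<eta>. y \<notin> N \<longrightarrow> \<delta> \<noteq> 0 \<longrightarrow>
        b (\<delta> *\<^sub>R y + X *v \<eta>) = \<delta> *\<^sub>R b y + \<eta> \<and>
        Om (\<delta> *\<^sub>R y + X *v \<eta>) = \<delta>\<^sup>2 *\<^sub>R Om y) \<and>
     (AE y in lborel. y \<notin> N \<longrightarrow> invertible (Om y))"

definition N_star :: "(real^'n \<Rightarrow> real^'q^'q) \<Rightarrow> (real^'n) set \<Rightarrow> (real^'n) set" where
  "N_star Om N = N \<union> {y. y \<notin> N \<and> det (Om y) = 0}"

definition F_type_stat ::
  "real^'k^'q \<Rightarrow> real^'q \<Rightarrow> (real^'n \<Rightarrow> real^'k) \<Rightarrow> (real^'n \<Rightarrow> real^'q^'q) \<Rightarrow> (real^'n) set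
     \<Rightarrow> real^'n \<Rightarrow> real" where
  "F_type_stat R r b Om N y =
     (if y \<in> N_star Om N then 0
      else (R *v b y - r) \<bullet> (matrix_inv (Om y) *v (R *v b y - r)))"

section \<open>Positive definiteness of the covariance matrices\<close>

lemma Sigma_spec_sym:
  assumes "f \<in> F_all"
  shows "transpose (Sigma_spec t f) = (Sigma_spec t f :: real^'n^'n)"
    and "Sigma_spec t f $ j $ l = (LINT \<omega>:{-pi..pi}|lebesgue. cos ((real (t j) - real (t l)) * \<omega>) * f \<omega>)"
    and "set_integrable lebesgue {-pi..pi} (\<lambda>\<omega>. cos ((real (t j) - real (t l)) * \<omega>) * f \<omega>)"
proof -
  have f: "set_integrable lebesgue {-pi..pi} f" using assms by (simp add: F_all_def)
  define e :: "'n \<Rightarrow> 'n \<Rightarrow> real \<Rightarrow> complex"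
    where "e j l \<omega> = exp (- \<i> * (of_nat (t j) - of_nat (t l)) * of_real \<omega>)" for j l \<omega>
  have e_alt: "e j l \<omega> = cis (- ((real (t j) - real (t l)) * \<omega>))" for j l \<omega>
    unfolding e_def cis_conv_exp by (simp add: algebra_simps)
  have m: "e j l \<in> borel_measurable lebesgue" for j l
    unfolding e_alt[abs_def]
    by (rule measurable_completion)
       (auto intro!: borel_measurable_continuous_onI continuous_intros)
  have i: "set_integrable lebesgue {-pi..pi} (\<lambda>\<omega>. e j l \<omega> * of_real (f \<omega>))" for j l
    unfolding set_integrable_def
  proof (rule Bochner_Integration.integrable_bound)
    show "integrable lebesgue (\<lambda>\<omega>. indicator {-pi..pi} \<omega> *\<^sub>R f \<omega>)"
      using f by (simp add: set_integrable_def)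
    then have "(\<lambda>\<omega>. complex_of_real (indicator {-pi..pi} \<omega> *\<^sub>R f \<omega>)) \<in> borel_measurable lebesgue"
      by (intro measurable_compose[OF borel_measurable_integrable borel_measurable_of_real])
    from borel_measurable_times[OF m this, of j l]
    show "(\<lambda>\<omega>. indicator {-pi..pi} \<omega> *\<^sub>R (e j l \<omega> * of_real (f \<omega>))) \<in> borel_measurable lebesgue"
      by (simp add: scaleR_conv_of_real mult_ac)
    show "AE \<omega> in lebesgue. norm (indicator {-pi..pi} \<omega> *\<^sub>R (e j l \<omega> * complex_of_real (f \<omega>)))
             \<le> norm (indicator {-pi..pi} \<omega> *\<^sub>R f \<omega>)"
      by (simp add: e_alt norm_mult)
  qed
  have re: "Re (indicator {-pi..pi} \<omega> *\<^sub>R (e j l \<omega> * complex_of_real (f \<omega>)))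
     = indicator {-pi..pi} \<omega> *\<^sub>R (cos ((real (t j) - real (t l)) * \<omega>) * f \<omega>)" for j l \<omega>
    by (simp add: e_alt)
  show c: "set_integrable lebesgue {-pi..pi} (\<lambda>\<omega>. cos ((real (t j) - real (t l)) * \<omega>) * f \<omega>)" for j l
    using integrable_Re[OF i[of j l, unfolded set_integrable_def]]
    unfolding set_integrable_def re .
  show s: "Sigma_spec t f $ j $ l = (LINT \<omega>:{-pi..pi}|lebesgue. cos ((real (t j) - real (t l)) * \<omega>) * f \<omega>)"
    for j l
    using integral_Re[OF i[of j l, unfolded set_integrable_def]]
    unfolding Sigma_spec_def set_lebesgue_integral_def re e_def[symmetric] by simp
  have "cos ((real (t j) - real (t l)) * \<omega>) = cos ((real (t l) - real (t j)) * \<omega>)" for j l \<omega>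
    by (metis cos_minus minus_diff_eq mult_minus_left)
  then show "transpose (Sigma_spec t f) = Sigma_spec t f"
    by (simp add: vec_eq_iff transpose_def s)
qed

lemma finite_trig_zeros:
  fixes t :: "'n::finite \<Rightarrow> nat" and z :: "real^'n"
  assumes "inj t" "z \<noteq> 0"
  shows "finite {\<omega> \<in> {-pi..pi}. (\<Sum>j\<in>UNIV. of_real (z $ j) * cis (real (t j) * \<omega>)) = 0}"
proof -
  define p where "p = (\<Sum>j\<in>UNIV. monom (complex_of_real (z $ j)) (t j))"
  obtain j0 where "z $ j0 \<noteq> 0" using \<open>z \<noteq> 0\<close> by (auto simp: vec_eq_iff)
  moreover have "coeff p (t j0) = of_real (z $ j0)"
    using \<open>inj t\<close> by (simp add: p_def coeff_sum inj_eq if_distrib sum.delta cong: if_cong)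
  ultimately have "p \<noteq> 0" by auto
  then have fin: "finite {x. poly p x = 0}" by (rule poly_roots_finite)
  have ev: "poly p (cis \<omega>) = (\<Sum>j\<in>UNIV. of_real (z $ j) * cis (real (t j) * \<omega>))" for \<omega>
    by (simp add: p_def poly_sum poly_monom Complex.DeMoivre)
  have "inj_on cis {-pi<..pi}"
    by (rule inj_on_inverseI[where g = Arg]) (simp add: Arg_cis)
  then have "inj_on cis {\<omega> \<in> {-pi<..pi}. poly p (cis \<omega>) = 0}"
    by (rule inj_on_subset) auto
  moreover have "finite (cis ` {\<omega> \<in> {-pi<..pi}. poly p (cis \<omega>) = 0})"
    by (rule finite_subset[OF _ fin]) auto
  ultimately have "finite {\<omega> \<in> {-pi<..pi}. poly p (cis \<omega>) = 0}"
    by (rule finite_imageD[rotated])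
  then have "finite (insert (-pi) {\<omega> \<in> {-pi<..pi}. poly p (cis \<omega>) = 0})" by simp
  then show ?thesis
    by (rule finite_subset[rotated]) (auto simp: ev)
qed

lemma Sigma_spec_pos_def:
  fixes t :: "'n::finite \<Rightarrow> nat" and z :: "real^'n"
  assumes F: "f \<in> F_all" and t: "inj t" and z: "z \<noteq> 0"
  shows "z \<bullet> (Sigma_spec t f *v z) > 0"
proof -
  define g where "g \<omega> = (\<Sum>j\<in>UNIV. of_real (z $ j) * cis (real (t j) * \<omega>))" for \<omega>
  define h where "h \<omega> = indicator {-pi..pi} \<omega> * ((cmod (g \<omega>))\<^sup>2 * f \<omega>)" for \<omega>
  have nn: "0 \<le> f \<omega>" if "\<omega> \<in> {-pi..pi}" for \<omega>
    using F that by (auto simp: F_all_def PiE_iff)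
  have "complex_of_real ((cmod (g \<omega>))\<^sup>2) =
      (\<Sum>j\<in>UNIV. \<Sum>l\<in>UNIV. of_real (z $ j * z $ l) * cis ((real (t j) - real (t l)) * \<omega>))" for \<omega>
    unfolding complex_norm_square g_def
    by (simp add: sum_product cis_cnj cis_mult algebra_simps)
  then have "Re (complex_of_real ((cmod (g \<omega>))\<^sup>2)) =
      (\<Sum>j\<in>UNIV. \<Sum>l\<in>UNIV. z $ j * z $ l * cos ((real (t j) - real (t l)) * \<omega>))" for \<omega>
    by (simp only: Re_sum Re_complex_of_real) simp
  then have sq: "(cmod (g \<omega>))\<^sup>2 =
      (\<Sum>j\<in>UNIV. \<Sum>l\<in>UNIV. z $ j * z $ l * cos ((real (t j) - real (t l)) * \<omega>))" for \<omega>
    by (simp only: Re_complex_of_real)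
  have h: "h = (\<lambda>\<omega>. \<Sum>j\<in>UNIV. \<Sum>l\<in>UNIV. z $ j * z $ l *
      (indicator {-pi..pi} \<omega> *\<^sub>R (cos ((real (t j) - real (t l)) * \<omega>) * f \<omega>)))"
    unfolding h_def sq by (simp add: sum_distrib_left sum_distrib_right mult_ac)
  note int = Sigma_spec_sym(3)[OF F, of t, unfolded set_integrable_def]
  have hi: "integrable lebesgue h"
    unfolding h by (intro Bochner_Integration.integrable_sum integrable_mult_right int)
  have "z \<bullet> (Sigma_spec t f *v z) = (\<Sum>j\<in>UNIV. \<Sum>l\<in>UNIV. z $ j * z $ l * Sigma_spec t f $ j $ l)"
    by (simp add: inner_vec_def matrix_vector_mult_def sum_distrib_left mult_ac)
  also have "\<dots> = integral\<^sup>L lebesgue h"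
    unfolding h Sigma_spec_sym(2)[OF F] set_lebesgue_integral_def
    by (simp only: Bochner_Integration.integral_sum Bochner_Integration.integrable_sum
        integrable_mult_right integral_mult_right_zero int)
  finally have q: "z \<bullet> (Sigma_spec t f *v z) = integral\<^sup>L lebesgue h" .
  have h0: "0 \<le> h \<omega>" for \<omega> using nn by (auto simp: h_def indicator_def)
  have "integral\<^sup>L lebesgue h \<noteq> 0"
  proof
    assume "integral\<^sup>L lebesgue h = 0"
    then have "AE \<omega> in lebesgue. h \<omega> = 0"
      using integral_nonneg_eq_0_iff_AE[OF hi] h0 by auto
    moreover have "AE \<omega> in lebesgue. \<omega> \<notin> {\<omega> \<in> {-pi..pi}. g \<omega> = 0}"
      using finite_trig_zeros[OF t z] unfolding g_def
      by (intro AE_not_in null_sets_completionI finite_imp_null_set_lborel)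
    ultimately have "AE \<omega> in lebesgue. indicator {-pi..pi} \<omega> *\<^sub>R f \<omega> = 0"
      by eventually_elim (auto simp: h_def indicator_def split: if_splits)
    then have "(LINT \<omega>:{-pi..pi}|lebesgue. f \<omega>) = 0"
      unfolding set_lebesgue_integral_def by (rule integral_eq_zero_AE)
    then show False using F by (simp add: F_all_def)
  qed
  moreover have "0 \<le> integral\<^sup>L lebesgue h" using h0 by (intro integral_nonneg_AE) auto
  ultimately show ?thesis using q by simp
qed

end

theory Submission
  imports Defs
begin

text \<open>
  For the lower bound, mixtures of white noise with \<open>AR(2)\<close> densities whose poles approach \<open>e\<^sup>\<plusminus>\<^sup>i\<^sup>\<gamma>\<close> have
  covariance matrices which, up to a factor, tend to \<open>V = I + A\<^sup>2 (c c' + s s')\<close> with \<open>c = (cos (\<gamma> j))\<^sub>j\<close> and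
  \<open>s = (sin (\<gamma> j))\<^sub>j\<close>; since \<open>T\<close> is invariant under scaling, Fatou's lemma allows passing to \<open>V\<close>.  By Taylor's
  formula the distance of \<open>A c\<close> and \<open>A s\<close> from \<open>span(X)\<close> is of order \<open>A \<gamma>\<^sup>k\<close>, \<open>k = k\<^sub>F\<close>, whereas their images
  under \<open>R \<beta>\<close>, \<open>\<beta>\<close> the least squares estimator, reach the order \<open>A \<gamma>\<^sup>p\<close> with some \<open>p < k\<^sub>F\<close>.  Choose \<open>\<gamma> \<rightarrow> 0\<close> and
  \<open>A\<close> such that the former vanishes and the latter diverges.  For \<open>G\<close> standard normal and a suitable square
  root \<open>L\<close> of \<open>V\<close>, the residuals of \<open>L G\<close> then converge to those of \<open>G\<close>, while the numerator of the statistic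
  diverges, so that \<open>T(L G) \<rightarrow> \<infinity>\<close> almost surely on the event that the variance estimator is positive at \<open>G\<close>.
  The upper bound holds because, almost everywhere, \<open>T\<close> has the sign of the variance estimator, which is
  invariant under translations along \<open>span(X)\<close>.
\<close>

section \<open>Linear images of Lebesgue measure\<close>

lemma nn_integral_lborel_translate:
  fixes h :: "'a::euclidean_space \<Rightarrow> ennreal"
  assumes [measurable]: "h \<in> borel_measurable borel"
  shows "(\<integral>\<^sup>+x. h (x + c) \<partial>lborel) = (\<integral>\<^sup>+x. h x \<partial>lborel)"
proof -
  have "(\<integral>\<^sup>+x. h x \<partial>lborel) = (\<integral>\<^sup>+x. h x \<partial>distr lborel borel ((+) c))"
    by (simp only: lborel_distr_plus)
  also have "\<dots> = (\<integral>\<^sup>+x. h (c + x) \<partial>lborel)"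
    by (subst nn_integral_distr) auto
  finally show ?thesis by (simp add: add.commute)
qed

text \<open>
  Averaging over translations along \<open>a\<close>: with \<open>\<integral>\<phi> = 1\<close>, insert \<open>\<integral>\<phi>(\<tau> - u \<bullet> x) d\<tau>\<close>, replace \<open>x\<close>
  by \<open>x - \<tau> a\<close>, and substitute \<open>\<tau> - u \<bullet> x\<close> for \<open>\<tau>\<close>.
\<close>

lemma nn_integral_lborel_shear:
  fixes h :: "'a::euclidean_space \<Rightarrow> ennreal"
  assumes h [measurable]: "h \<in> borel_measurable borel" and ua: "u \<bullet> a = 0"
  shows "(\<integral>\<^sup>+x. h (x + (u \<bullet> x) *\<^sub>R a) \<partial>lborel) = (\<integral>\<^sup>+x. h x \<partial>lborel)"
proof -
  define \<phi> :: "real \<Rightarrow> ennreal" where "\<phi> = indicator {0..1}"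
  have [measurable]: "\<phi> \<in> borel_measurable borel" by (simp add: \<phi>_def)
  have \<phi>: "(\<integral>\<^sup>+\<tau>. \<phi> (\<tau> - c) \<partial>lborel) = 1" for c
    using nn_integral_lborel_translate[of \<phi> "- c"] by (simp add: \<phi>_def)
  have "(\<integral>\<^sup>+x. h (x + (u \<bullet> x) *\<^sub>R a) \<partial>lborel)
      = (\<integral>\<^sup>+x. \<integral>\<^sup>+\<tau>. \<phi> (\<tau> + - (u \<bullet> x)) * h (x + (u \<bullet> x) *\<^sub>R a) \<partial>lborel \<partial>lborel)"
    by (simp add: nn_integral_multc \<phi>)
  also have "\<dots> = (\<integral>\<^sup>+\<tau>. \<integral>\<^sup>+x. \<phi> (\<tau> + - (u \<bullet> x)) * h (x + (u \<bullet> x) *\<^sub>R a) \<partial>lborel \<partial>lborel)"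
    by (rule lborel_pair.Fubini') measurable
  also have "\<dots> = (\<integral>\<^sup>+\<tau>. \<integral>\<^sup>+x. \<phi> (\<tau> + - (u \<bullet> x)) * h (x - (\<tau> + - (u \<bullet> x)) *\<^sub>R a) \<partial>lborel \<partial>lborel)"
  proof (rule nn_integral_cong)
    fix \<tau> :: real
    show "(\<integral>\<^sup>+x. \<phi> (\<tau> + - (u \<bullet> x)) * h (x + (u \<bullet> x) *\<^sub>R a) \<partial>lborel)
        = (\<integral>\<^sup>+x. \<phi> (\<tau> + - (u \<bullet> x)) * h (x - (\<tau> + - (u \<bullet> x)) *\<^sub>R a) \<partial>lborel)"
      by (subst nn_integral_lborel_translate[of _ "- (\<tau> *\<^sub>R a)", symmetric])
         (auto simp: inner_diff_right inner_scaleR_right ua algebra_simps)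
  qed
  also have "\<dots> = (\<integral>\<^sup>+x. \<integral>\<^sup>+\<tau>. \<phi> (\<tau> + - (u \<bullet> x)) * h (x - (\<tau> + - (u \<bullet> x)) *\<^sub>R a) \<partial>lborel \<partial>lborel)"
    by (rule lborel_pair.Fubini'[symmetric]) measurable
  also have "\<dots> = (\<integral>\<^sup>+x. \<integral>\<^sup>+\<tau>. \<phi> \<tau> * h (x - \<tau> *\<^sub>R a) \<partial>lborel \<partial>lborel)"
  proof (rule nn_integral_cong)
    fix x
    show "(\<integral>\<^sup>+\<tau>. \<phi> (\<tau> + - (u \<bullet> x)) * h (x - (\<tau> + - (u \<bullet> x)) *\<^sub>R a) \<partial>lborel)
        = (\<integral>\<^sup>+\<tau>. \<phi> \<tau> * h (x - \<tau> *\<^sub>R a) \<partial>lborel)"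
      by (rule nn_integral_lborel_translate) measurable
  qed
  also have "\<dots> = (\<integral>\<^sup>+\<tau>. \<integral>\<^sup>+x. \<phi> \<tau> * h (x - \<tau> *\<^sub>R a) \<partial>lborel \<partial>lborel)"
    by (rule lborel_pair.Fubini') measurable
  also have "\<dots> = (\<integral>\<^sup>+\<tau>. \<phi> \<tau> * (\<integral>\<^sup>+x. h x \<partial>lborel) \<partial>lborel)"
    using nn_integral_lborel_translate[OF h]
    by (simp add: nn_integral_cmult diff_conv_add_uminus del: add_uminus_conv_diff)
  also have "\<dots> = (\<integral>\<^sup>+x. h x \<partial>lborel)"
    using \<phi>[of 0] by (simp add: nn_integral_multc)
  finally show ?thesis .
qed

section \<open>Coordinates, elementary matrices, and null sets\<close>

lemma Basis_real_vec: "(Basis :: (real^'n) set) = range (\<lambda>i. axis i 1)"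
  by (auto simp: Basis_vec_def)

lemma prod_Basis_real_vec: "(\<Prod>b\<in>Basis. f b) = (\<Prod>i\<in>UNIV. f (axis i 1 :: real^'n))"
  unfolding Basis_real_vec by (subst prod.reindex) (auto simp: inj_on_def axis_eq_axis)

lemma sum_Basis_real_vec: "(\<Sum>b\<in>Basis. f b) = (\<Sum>i\<in>UNIV. f (axis i 1 :: real^'n))"
  unfolding Basis_real_vec by (subst sum.reindex) (auto simp: inj_on_def axis_eq_axis)

text \<open>The preimage of a box is the box with permuted sides, which has the same volume; the
  values on boxes determine Lebesgue measure.\<close>

lemma lborel_distr_permute:
  fixes p :: "'n::finite \<Rightarrow> 'n"
  assumes p: "bij p"
  shows "distr lborel borel (\<lambda>x::real^'n. \<chi> i. x $ p i) = lborel"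
proof (rule lborel_eqI[symmetric])
  fix l u :: "real^'n"
  assume le: "\<And>b. b \<in> Basis \<Longrightarrow> l \<bullet> b \<le> u \<bullet> b"
  have [measurable]: "(\<lambda>x::real^'n. \<chi> i. x $ p i) \<in> borel_measurable borel"
    by (intro borel_measurable_continuous_onI continuous_intros)
  define q where "q = inv p"
  have q: "p (q i) = i" "q (p i) = i" for i
    using p by (auto simp: q_def bij_is_surj surj_f_inv_f bij_is_inj inv_f_f)
  have pre: "(\<lambda>x. \<chi> i. x $ p i) -` box l u = box (\<chi> i. l $ q i) (\<chi> i. u $ q i)"
    by (auto simp: mem_box_cart) (metis q)+
  have Bprod: "(\<Prod>b\<in>Basis. (y - x) \<bullet> b) = (\<Prod>i\<in>UNIV. y $ i - x $ i)" for x y :: "real^'n"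
    by (simp add: prod_Basis_real_vec inner_axis)
  have le': "l $ i \<le> u $ i" for i
    using le[of "axis i 1"] by (simp add: inner_axis axis_in_Basis_iff)
  have "emeasure (distr lborel borel (\<lambda>x. \<chi> i. x $ p i)) (box l u)
      = emeasure lborel (box (\<chi> i. l $ q i) (\<chi> i. u $ q i))"
    by (subst emeasure_distr) (auto simp: pre)
  also have "\<dots> = (\<Prod>b\<in>Basis. ((\<chi> i. u $ q i) - (\<chi> i. l $ q i)) \<bullet> b)"
    by (subst emeasure_lborel_box_eq) (auto simp: Basis_vec_def inner_axis le')
  also have "\<dots> = (\<Prod>i\<in>UNIV. u $ q i - l $ q i)" by (simp add: Bprod)
  also have "(\<Prod>i\<in>UNIV. u $ q i - l $ q i) = (\<Prod>i\<in>UNIV. u $ i - l $ i)"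
    using p by (intro prod.reindex_bij_betw[where h = q and g = "\<lambda>i. u $ i - l $ i"])
      (simp add: q_def bij_imp_bij_inv)
  finally show "emeasure (distr lborel borel (\<lambda>x. \<chi> i. x $ p i)) (box l u) = (\<Prod>b\<in>Basis. (u - l) \<bullet> b)"
    by (simp add: Bprod)
qed simp

lemma borel_measurable_matrix_vector_mult [measurable]:
  "(*v) (A::real^'m^'n) \<in> borel_measurable borel"
  by (intro borel_measurable_continuous_onI linear_continuous_on matrix_vector_mul_bounded_linear)

text \<open>The change of variables theorems in \<open>HOL-Analysis\<close> require a well-ordered index type.\<close>

lemma nn_integral_lborel_matrix:
  fixes A :: "real^'n^'n" and h :: "real^'n \<Rightarrow> ennreal"
  assumes "det A \<noteq> 0" and "h \<in> borel_measurable borel"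
  shows "ennreal \<bar>det A\<bar> * (\<integral>\<^sup>+x. h (A *v x) \<partial>lborel) = (\<integral>\<^sup>+x. h x \<partial>lborel)"
proof -
  \<comment> \<open>For singular matrices the predicate is vacuous, which settles matrices with a
    zero row. Products reduce to their factors since \<open>det\<close> is multiplicative. Diagonal
    matrices, swaps and shears remain.\<close>
  define P where "P A \<longleftrightarrow> (det A \<noteq> 0 \<longrightarrow> (\<forall>h\<in>borel_measurable borel.
     ennreal \<bar>det A\<bar> * (\<integral>\<^sup>+x. h (A *v x) \<partial>lborel) = (\<integral>\<^sup>+x. h x \<partial>lborel)))" for A :: "real^'n^'n"
  have "P A"
  proof (rule induct_matrix_elementary)
    fix A B :: "real^'n^'n" assume A: "P A" and B: "P B"
    show "P (A ** B)"
      unfolding P_def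
    proof (intro impI ballI)
      fix h :: "real^'n \<Rightarrow> ennreal"
      assume d: "det (A ** B) \<noteq> 0" and [measurable]: "h \<in> borel_measurable borel"
      have "ennreal \<bar>det (A ** B)\<bar> * (\<integral>\<^sup>+x. h ((A ** B) *v x) \<partial>lborel)
          = ennreal \<bar>det A\<bar> * (ennreal \<bar>det B\<bar> * (\<integral>\<^sup>+x. h (A *v (B *v x)) \<partial>lborel))"
        by (simp add: det_mul abs_mult ennreal_mult mult.assoc matrix_vector_mul_assoc)
      also have "ennreal \<bar>det B\<bar> * (\<integral>\<^sup>+x. h (A *v (B *v x)) \<partial>lborel) = (\<integral>\<^sup>+x. h (A *v x) \<partial>lborel)"
        using B d unfolding P_def
        by (auto simp: det_mul dest!: bspec[where x = "\<lambda>x. h (A *v x)"])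
      also have "ennreal \<bar>det A\<bar> * \<dots> = (\<integral>\<^sup>+x. h x \<partial>lborel)"
        using A d unfolding P_def by (auto simp: det_mul)
      finally show "ennreal \<bar>det (A ** B)\<bar> * (\<integral>\<^sup>+x. h ((A ** B) *v x) \<partial>lborel) = (\<integral>\<^sup>+x. h x \<partial>lborel)" .
    qed
  next
    fix A :: "real^'n^'n" and i assume "row i A = 0"
    then show "P A" unfolding P_def using det_zero_row by blast
  next
    fix A :: "real^'n^'n" assume A: "\<And>i j. i \<noteq> j \<Longrightarrow> A $ i $ j = 0"
    have det: "det A = (\<Prod>i\<in>UNIV. A $ i $ i)" by (rule det_diagonal) (rule A)
    show "P A"
      unfolding P_def
    proof (intro impI ballI)
      fix h :: "real^'n \<Rightarrow> ennreal"
      assume d: "det A \<noteq> 0" and [measurable]: "h \<in> borel_measurable borel"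
      define c where "c b = b \<bullet> (A *v b)" for b :: "real^'n"
      have c: "c (axis i 1) = A $ i $ i" for i
        by (simp add: c_def matrix_vector_mult_basis inner_axis' column_def)
      have c0: "c b \<noteq> 0" if "b \<in> Basis" for b
        using that d by (auto simp: det Basis_vec_def c)
      \<comment> \<open>This is the coordinate form of a diagonal map in which
        \<open>lborel_affine_euclidean\<close> describes the image measure.\<close>
      have T: "0 + (\<Sum>j\<in>Basis. (c j * (x \<bullet> j)) *\<^sub>R j) = A *v x" for x
        unfolding sum_Basis_real_vec vec_eq_iff
      proof
        fix i
        have Ax: "(A *v x) $ i = (\<Sum>j\<in>UNIV. if j = i then A $ i $ i * x $ i else 0)"
          unfolding matrix_vector_mult_def vec_lambda_beta
          by (rule sum.cong) (auto simp: A)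
        have ax: "axis j (1::real) $ i = (if j = i then 1 else 0)" for j
          by (simp add: axis_def)
        have "(\<Sum>j\<in>UNIV. ((c (axis j 1) * (x \<bullet> axis j 1)) *\<^sub>R (axis j 1 :: real^'n)) $ i)
            = (\<Sum>j\<in>UNIV. if j = i then A $ i $ i * x $ i else 0)"
          by (rule sum.cong) (auto simp: c inner_axis ax)
        then show "(0 + (\<Sum>j\<in>UNIV. (c (axis j 1) * (x \<bullet> axis j 1)) *\<^sub>R axis j 1)) $ i = (A *v x) $ i"
          by (simp only: Ax sum_component add_0_left)
      qed
      have "(\<Prod>j\<in>Basis. \<bar>c j\<bar>) = \<bar>det A\<bar>"
        by (simp add: prod_Basis_real_vec c det abs_prod)
      then have lb: "lborel = density (distr lborel borel ((*v) A)) (\<lambda>_. ennreal \<bar>det A\<bar>)"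
        using lborel_affine_euclidean[where c = c and t = 0, OF c0] unfolding T by simp
      have "(\<integral>\<^sup>+x. h x \<partial>lborel) = (\<integral>\<^sup>+x. ennreal \<bar>det A\<bar> * h (A *v x) \<partial>lborel)"
        by (subst lb) (simp add: nn_integral_density nn_integral_distr)
      then show "ennreal \<bar>det A\<bar> * (\<integral>\<^sup>+x. h (A *v x) \<partial>lborel) = (\<integral>\<^sup>+x. h x \<partial>lborel)"
        by (simp add: nn_integral_cmult)
    qed
  next
    fix m n :: 'n assume "m \<noteq> n"
    let ?\<tau> = "Transposition.transpose m n"
    let ?A = "(\<chi> i j. mat 1 $ i $ ?\<tau> j) :: real^'n^'n"
    have A: "?A *v x = (\<chi> i. x $ ?\<tau> i)" for x :: "real^'n"
    proof -
      have "i = ?\<tau> j \<longleftrightarrow> j = ?\<tau> i" for i j by (metis transpose_involutory)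
      then have "(\<Sum>j\<in>UNIV. if i = ?\<tau> j then x $ j else 0) = (\<Sum>j\<in>UNIV. if j = ?\<tau> i then x $ j else 0)" for i
        by (intro sum.cong if_cong refl)
      then show ?thesis
        by (simp add: vec_eq_iff matrix_vector_mult_def mat_def if_distrib if_distribR cong: if_cong)
    qed
    have d: "\<bar>det ?A\<bar> = 1"
      using det_permute_columns[where p = ?\<tau> and A = "mat 1 :: real^'n^'n"]
      by (simp add: permutes_swap_id sign_swap_id)
    show "P ?A"
      unfolding P_def d A
    proof (intro impI ballI)
      fix h :: "real^'n \<Rightarrow> ennreal" assume [measurable]: "h \<in> borel_measurable borel"
      have [measurable]: "(\<lambda>x::real^'n. \<chi> i. x $ ?\<tau> i) \<in> borel_measurable borel"
        by (intro borel_measurable_continuous_onI continuous_intros)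
      have "(\<integral>\<^sup>+x. h x \<partial>lborel) = (\<integral>\<^sup>+x. h x \<partial>distr lborel borel (\<lambda>x. \<chi> i. x $ ?\<tau> i))"
        by (simp add: lborel_distr_permute)
      then show "ennreal 1 * (\<integral>\<^sup>+x. h (\<chi> i. x $ ?\<tau> i) \<partial>lborel) = (\<integral>\<^sup>+x. h x \<partial>lborel)"
        by (simp add: nn_integral_distr)
    qed
  next
    fix m n :: 'n and c :: real assume mn: "m \<noteq> n"
    let ?A = "(\<chi> i j. if i = m \<and> j = n then c else of_bool (i = j)) :: real^'n^'n"
    \<comment> \<open>The row operation is the shear along \<open>axis m 1\<close> with the
      functional given by \<open>axis n c\<close>; these vectors are orthogonal since
      \<open>m \<noteq> n\<close>.\<close>
    have A: "?A *v x = x + (axis n c \<bullet> x) *\<^sub>R axis m 1" for x :: "real^'n"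
    proof -
      have "(\<Sum>j\<in>UNIV. (if i = m \<and> j = n then c else of_bool (i = j)) * x $ j)
          = (\<Sum>j\<in>UNIV. (if j = i then x $ j else 0) + (if j = n then (if i = m then c * x $ n else 0) else 0))"
        for i using mn by (intro sum.cong) auto
      moreover have "axis n c \<bullet> x = c * x $ n" by (simp add: inner_axis')
      moreover have "axis m (1::real) $ i = (if i = m then 1 else 0)" for i by (simp add: axis_def)
      ultimately show ?thesis
        by (simp add: vec_eq_iff matrix_vector_mult_def sum.distrib)
    qed
    have "?A = (\<chi> k. if k = m then row m (mat 1) + c *s row n (mat 1) else row k (mat 1))"
      using mn by (auto simp: vec_eq_iff row_def mat_def)
    then have d: "det ?A = 1" by (simp only: det_row_operation[OF mn] det_I)
    show "P ?A"
      unfolding P_def d A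
      using nn_integral_lborel_shear[of _ "axis n c" "axis m (1::real)"] mn
      by (auto simp: inner_axis_axis)
  qed
  then show ?thesis using assms by (simp add: P_def)
qed

text \<open>Averaging the volume over the translates of \<open>Z\<close> along \<open>v\<close> and
  exchanging the integrals leaves, for each \<open>x\<close>, an integral over a finite subset of
  the line. This disposes of hyperplanes and of zero sets of quadratic forms.\<close>

lemma null_set_if_finite_lines:
  fixes Z :: "'a::euclidean_space set"
  assumes Z [measurable]: "Z \<in> sets borel" and fin: "\<And>x. finite {\<tau>. x + \<tau> *\<^sub>R v \<in> Z}"
  shows "Z \<in> null_sets lborel"
proof -
  have "emeasure lborel Z = (\<integral>\<^sup>+\<tau>. indicator {0..1::real} \<tau> * emeasure lborel Z \<partial>lborel)"
    by (simp add: nn_integral_multc)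
  also have "\<dots> = (\<integral>\<^sup>+\<tau>. \<integral>\<^sup>+x. indicator {0..1::real} \<tau> * indicator Z (x + \<tau> *\<^sub>R v) \<partial>lborel \<partial>lborel)"
    by (simp add: nn_integral_cmult nn_integral_lborel_translate[where h = "indicator Z"])
  also have "\<dots> = (\<integral>\<^sup>+x. \<integral>\<^sup>+\<tau>. indicator {0..1::real} \<tau> * indicator Z (x + \<tau> *\<^sub>R v) \<partial>lborel \<partial>lborel)"
    by (rule lborel_pair.Fubini') measurable
  also have "\<dots> = (\<integral>\<^sup>+x. 0 \<partial>(lborel :: 'a measure))"
  proof (rule nn_integral_cong)
    fix x
    have "AE \<tau> in lborel. \<tau> \<notin> {\<tau>. x + \<tau> *\<^sub>R v \<in> Z}"
      by (intro AE_not_in finite_imp_null_set_lborel fin)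
    then have "AE \<tau> in lborel. indicator {0..1} \<tau> * indicator Z (x + \<tau> *\<^sub>R v) = (0::ennreal)"
      by eventually_elim (auto simp: indicator_def)
    then show "(\<integral>\<^sup>+\<tau>. indicator {0..1::real} \<tau> * indicator Z (x + \<tau> *\<^sub>R v) \<partial>lborel) = (0::ennreal)"
      by (subst nn_integral_0_iff_AE) auto
  qed
  finally show ?thesis using Z by (auto simp: null_sets_def)
qed

section \<open>Gaussian measures\<close>

lemma sets_gaussian [simp, measurable_cong]: "sets (gaussian \<mu> A) = sets borel"
  by (simp add: gaussian_def)

lemma space_gaussian [simp]: "space (gaussian \<mu> A) = UNIV"
  by (simp add: gaussian_def)

lemma AE_gaussian:
  assumes "AE y in lborel. Q y"
  shows "AE y in gaussian \<mu> A. Q y"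
proof -
  have [measurable]: "(\<lambda>y. ennreal (exp (- ((y - \<mu>) \<bullet> (matrix_inv A *v (y - \<mu>))) / 2) /
      sqrt ((2 * pi) ^ CARD('b) * det A))) \<in> borel_measurable borel"
    by measurable
  show ?thesis unfolding gaussian_def by (subst AE_density) (use assms in auto)
qed

lemma matrix_inv_inverse:
  fixes A :: "real^'n^'n"
  assumes "invertible A"
  shows "A ** matrix_inv A = mat 1" "matrix_inv A ** A = mat 1"
  using assms unfolding invertible_def matrix_inv_def by (metis (mono_tags, lifting) someI_ex)+

lemma matrix_inv_eqI:
  fixes A :: "real^'n^'n"
  assumes "A ** B = mat 1"
  shows "matrix_inv A = B"
proof -
  have "invertible A" using assms invertible_right_inverse by blast
  then show ?thesis
    by (metis assms matrix_inv_inverse(2) matrix_mul_assoc matrix_mul_lid matrix_mul_rid)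
qed

text \<open>Substituting \<open>\<mu> + L *v z\<close> in the density, the Jacobian cancels against
  the factor by which the normalizing constant changes, and the quadratic form in the exponent
  becomes that of \<open>V\<close>.\<close>

lemma emeasure_gaussian_linear:
  fixes L V :: "real^'n^'n"
  assumes L: "invertible L" and V: "invertible V" and [measurable]: "B \<in> sets borel"
  shows "emeasure (gaussian \<mu> (L ** V ** transpose L)) B = emeasure (gaussian 0 V) {z. \<mu> + L *v z \<in> B}"
proof -
  define g where "g V y = ennreal (exp (- (y \<bullet> (matrix_inv V *v y)) / 2) / sqrt ((2 * pi) ^ CARD('n) * det V))"
    for V :: "real^'n^'n" and y
  have [measurable]: "g V \<in> borel_measurable borel" for V unfolding g_def by measurable
  have G: "emeasure (gaussian \<mu> V) B = (\<integral>\<^sup>+y. g V (y - \<mu>) * indicator B y \<partial>lborel)"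
    if "B \<in> sets borel" for V \<mu> B
    unfolding gaussian_def using that
    by (subst emeasure_density) (auto simp: g_def intro!: nn_integral_cong)
  have d: "det L \<noteq> 0" using L by (simp add: invertible_det_nz)
  let ?V = "L ** V ** transpose L"
  have inv: "matrix_inv ?V = matrix_inv (transpose L) ** matrix_inv V ** matrix_inv L"
  proof (rule matrix_inv_eqI)
    have "invertible (transpose L)" using L by (rule transpose_invertible)
    then show "?V ** (matrix_inv (transpose L) ** matrix_inv V ** matrix_inv L) = mat 1"
      using L V
      by (metis (no_types, lifting) matrix_inv_inverse(1) matrix_mul_assoc matrix_mul_rid)
  qed
  have q: "(L *v z) \<bullet> (matrix_inv ?V *v (L *v z)) = z \<bullet> (matrix_inv V *v z)" for z
  proof -
    have "invertible (transpose L)" using L by (rule transpose_invertible)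
    moreover have "matrix_inv ?V *v (L *v z) = matrix_inv (transpose L) *v (matrix_inv V *v z)"
      unfolding inv using matrix_inv_inverse(2)[OF L]
      by (metis matrix_vector_mul_assoc matrix_vector_mul_lid)
    ultimately show ?thesis
      by (metis dot_lmul_matrix matrix_inv_inverse(1) matrix_vector_mul_assoc matrix_vector_mul_lid
          transpose_transpose vector_transpose_matrix)
  qed
  have "sqrt ((2 * pi) ^ CARD('n) * det ?V) = \<bar>det L\<bar> * sqrt ((2 * pi) ^ CARD('n) * det V)"
  proof -
    have "(2 * pi) ^ CARD('n) * det ?V = (det L)\<^sup>2 * ((2 * pi) ^ CARD('n) * det V)"
      by (simp add: det_mul power2_eq_square)
    then show ?thesis by (simp add: real_sqrt_mult)
  qed
  then have gL: "ennreal \<bar>det L\<bar> * g ?V (L *v z) = g V z" for z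
    unfolding g_def q using d by (simp add: ennreal_mult'[symmetric])
  have "emeasure (gaussian \<mu> ?V) B = (\<integral>\<^sup>+y. g ?V y * indicator B (\<mu> + y) \<partial>lborel)"
    by (simp add: G) (subst nn_integral_lborel_translate[symmetric, where c = \<mu>],
      auto simp: add.commute)
  also have "\<dots> = ennreal \<bar>det L\<bar> * (\<integral>\<^sup>+z. g ?V (L *v z) * indicator B (\<mu> + L *v z) \<partial>lborel)"
    by (rule nn_integral_lborel_matrix[OF d, symmetric]) measurable
  also have "\<dots> = (\<integral>\<^sup>+z. g V z * indicator {z. \<mu> + L *v z \<in> B} z \<partial>lborel)"
    by (subst nn_integral_cmult[symmetric])
       (auto simp: gL mult.assoc[symmetric] indicator_def intro!: nn_integral_cong)
  also have "\<dots> = emeasure (gaussian 0 V) {z. \<mu> + L *v z \<in> B}"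
    by (subst G) auto
  finally show ?thesis .
qed

lemma emeasure_gaussian_scale:
  fixes V :: "real^'n^'n"
  assumes "s > 0" and V: "invertible V" and B: "B \<in> sets borel"
  shows "emeasure (gaussian \<mu> (s\<^sup>2 *\<^sub>R V)) B = emeasure (gaussian 0 V) {z. \<mu> + s *\<^sub>R z \<in> B}"
proof -
  have 1: "s *\<^sub>R mat 1 ** A = s *\<^sub>R A" for A :: "real^'n^'n"
    using scalar_matrix_assoc[of s "mat 1" A] by simp
  have 2: "invertible (s *\<^sub>R mat 1 :: real^'n^'n)"
    unfolding invertible_right_inverse using \<open>s > 0\<close>
    by (intro exI[of _ "inverse s *\<^sub>R mat 1"]) (simp add: 1)
  have 3: "(s *\<^sub>R mat 1) ** V ** transpose (s *\<^sub>R mat 1) = s\<^sup>2 *\<^sub>R V"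
    by (simp add: 1 transpose_scalar matrix_scalar_ac power2_eq_square)
  show ?thesis
    using emeasure_gaussian_linear[OF 2 V B, of \<mu>] unfolding 3
    by (simp add: scaleR_matrix_vector_assoc[symmetric])
qed

section \<open>Limits of Gaussian measures\<close>

lemma pos_def_imp_invertible:
  fixes V :: "real^'n^'n"
  assumes "\<And>z. z \<noteq> 0 \<Longrightarrow> z \<bullet> (V *v z) > 0"
  shows "invertible V"
proof -
  have "z = 0" if "V *v z = 0" for z
    using assms[of z] that by fastforce
  then show ?thesis
    by (simp add: invertible_left_inverse matrix_left_invertible_ker)
qed

text \<open>The densities converge pointwise, and Fatou's lemma carries the bound over to the limit.
  The uniform lower bound on the quadratic forms prevents degeneration: it survives in the limit and
  keeps the inverses bounded.\<close>

lemma emeasure_gaussian_lower_semicontinuous: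
  fixes V :: "nat \<Rightarrow> real^'n^'n"
  assumes V: "\<And>j l. (\<lambda>m. V m $ j $ l) \<longlonglongrightarrow> V' $ j $ l" and pos: "\<And>m z. z \<bullet> (V m *v z) \<ge> z \<bullet> z"
    and [measurable]: "B \<in> sets borel" and le: "\<And>m. emeasure (gaussian 0 (V m)) B \<le> s"
  shows "emeasure (gaussian 0 V') B \<le> s"
proof -
  have Vz: "(\<lambda>m. V m *v z) \<longlonglongrightarrow> V' *v z" for z
    unfolding matrix_vector_mult_def by (intro vec_tendstoI) (auto intro!: tendsto_intros V)
  have pos': "z \<bullet> (V' *v z) \<ge> z \<bullet> z" for z
    by (rule LIMSEQ_le_const[where X = "\<lambda>m. z \<bullet> (V m *v z)"]) (auto intro!: tendsto_intros Vz pos)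
  have iV: "invertible (V m)" for m
    by (rule pos_def_imp_invertible) (use pos order_less_le_trans inner_gt_zero_iff in blast)
  have iV': "invertible V'"
    by (rule pos_def_imp_invertible) (use pos' order_less_le_trans inner_gt_zero_iff in blast)
  \<comment> \<open>For \<open>x\<close> the image of \<open>y\<close> under the inverse,
    \<open>x \<bullet> x\<close> is at most \<open>x \<bullet> y\<close>; hence every inverse is a
    contraction.\<close>
  have bound: "norm (matrix_inv (V m) *v y) \<le> norm y" for m y
  proof -
    let ?x = "matrix_inv (V m) *v y"
    have "V m *v ?x = y" using matrix_inv_inverse(1)[OF iV] by (simp add: matrix_vector_mul_assoc)
    then have "norm ?x * norm ?x \<le> ?x \<bullet> y" using pos[of ?x m] by (simp add: norm_eq_square power2_norm_eq_inner[symmetric] power2_eq_square)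
    also have "\<dots> \<le> norm ?x * norm y" by (rule norm_cauchy_schwarz)
    finally show ?thesis by (cases "?x = 0") auto
  qed
  have lim_inv: "(\<lambda>m. matrix_inv (V m) *v y) \<longlonglongrightarrow> matrix_inv V' *v y" for y
  proof -
    let ?x = "matrix_inv V' *v y"
    \<comment> \<open>The resolvent identity; the contraction property then reduces convergence of
      the inverses to that of \<open>V m\<close> at the fixed vector \<open>?x\<close>.\<close>
    have e: "matrix_inv (V m) *v y - ?x = matrix_inv (V m) *v (V' *v ?x - V m *v ?x)" for m
      using matrix_inv_inverse(2)[OF iV] matrix_inv_inverse(1)[OF iV']
      by (simp add: matrix_vector_mult_diff_distrib matrix_vector_mul_assoc matrix_mul_assoc)
    have "(\<lambda>m. V' *v ?x - V m *v ?x) \<longlonglongrightarrow> 0"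
      using tendsto_diff[OF tendsto_const[of "V' *v ?x"] Vz[of ?x]] by simp
    then have "(\<lambda>m. matrix_inv (V m) *v y - ?x) \<longlonglongrightarrow> 0"
      by (rule Lim_null_comparison[rotated, OF tendsto_norm_zero]) (simp add: e bound)
    then show ?thesis by (simp add: LIM_zero_iff)
  qed
  have det: "(\<lambda>m. det (V m)) \<longlonglongrightarrow> det V'"
    unfolding det_def by (intro tendsto_intros V)
  define g where "g V y = ennreal (exp (- (y \<bullet> (matrix_inv V *v y)) / 2) / sqrt ((2 * pi) ^ CARD('n) * det V))"
    for V :: "real^'n^'n" and y
  have [measurable]: "g V \<in> borel_measurable borel" for V unfolding g_def by measurable
  have G: "emeasure (gaussian 0 V) B = (\<integral>\<^sup>+y. g V y * indicator B y \<partial>lborel)" for V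
    unfolding gaussian_def
    by (subst emeasure_density) (auto simp: g_def intro!: nn_integral_cong)
  have "(\<lambda>m. g (V m) y) \<longlonglongrightarrow> g V' y" for y
    unfolding g_def using iV'
    by (intro tendsto_ennrealI tendsto_intros lim_inv det) (auto simp: invertible_det_nz)
  then have "(\<lambda>m. g (V m) y * indicator B y) \<longlonglongrightarrow> g V' y * indicator B y" for y
    by (cases "y \<in> B") auto
  then have "liminf (\<lambda>m. g (V m) y * indicator B y) = g V' y * indicator B y" for y
    by (intro lim_imp_Liminf) auto
  then have "emeasure (gaussian 0 V') B = (\<integral>\<^sup>+y. liminf (\<lambda>m. g (V m) y * indicator B y) \<partial>lborel)"
    by (simp add: G)
  also have "\<dots> \<le> liminf (\<lambda>m. \<integral>\<^sup>+y. g (V m) y * indicator B y \<partial>lborel)"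
    by (rule nn_integral_liminf) measurable
  also have "\<dots> \<le> s"
    using le unfolding G by (intro Liminf_le) auto
  finally show ?thesis .
qed

section \<open>Autoregressive spectral densities concentrating at a frequency\<close>

lemma abs_sin_nat_mult_le: "\<bar>sin (real n * x)\<bar> \<le> real n * \<bar>sin x\<bar>"
proof (induction n)
  case (Suc n)
  have "\<bar>sin (real (Suc n) * x)\<bar> = \<bar>sin (real n * x) * cos x + cos (real n * x) * sin x\<bar>"
    using sin_add[of "real n * x" x] by (simp add: distrib_right add.commute)
  also have "\<dots> \<le> \<bar>sin (real n * x)\<bar> * \<bar>cos x\<bar> + \<bar>cos (real n * x)\<bar> * \<bar>sin x\<bar>"
    by (simp add: abs_mult[symmetric] abs_triangle_ineq)
  also have "\<dots> \<le> \<bar>sin (real n * x)\<bar> * 1 + 1 * \<bar>sin x\<bar>"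
    by (intro add_mono mult_mono) auto
  finally show ?case using Suc by (simp add: algebra_simps)
qed simp

text \<open>Both differences factor into sines of the half sum and the half difference, to which the
  previous bound applies. All autocovariances are thereby controlled by
  \<open>cos \<omega> - cos \<gamma>\<close>, which vanishes at both spectral peaks, \<gamma> and
  -\<gamma>.\<close>

lemma cos_nat_mult_diff_le: "\<bar>cos (real n * x) - cos (real n * y)\<bar> \<le> (real n)\<^sup>2 * \<bar>cos x - cos y\<bar>"
proof -
  define a b where "a = (x + y) / 2" and "b = (y - x) / 2"
  have "\<bar>cos (real n * x) - cos (real n * y)\<bar> = 2 * \<bar>sin (real n * a)\<bar> * \<bar>sin (real n * b)\<bar>"
    by (simp add: cos_diff_cos abs_mult a_def b_def algebra_simps)
  also have "\<dots> \<le> 2 * (real n * \<bar>sin a\<bar>) * (real n * \<bar>sin b\<bar>)"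
    by (intro mult_mono abs_sin_nat_mult_le) auto
  also have "\<dots> = (real n)\<^sup>2 * \<bar>cos x - cos y\<bar>"
    by (simp add: cos_diff_cos abs_mult a_def b_def power2_eq_square algebra_simps)
  finally show ?thesis .
qed

text \<open>The autoregressive polynomial with zeros \<open>\<rho>\<inverse> e\<^sup>\<plusminus>\<^sup>i\<^sup>\<gamma>\<close>.\<close>

definition ar2_poly :: "real \<Rightarrow> real \<Rightarrow> complex \<Rightarrow> complex" where
  "ar2_poly \<rho> \<gamma> z = 1 - of_real (2 * \<rho> * cos \<gamma>) * z - of_real (- (\<rho>\<^sup>2)) * z\<^sup>2"

lemma ar2_poly_factor: "ar2_poly \<rho> \<gamma> z = (1 - \<rho> * cis \<gamma> * z) * (1 - \<rho> * cis (- \<gamma>) * z)"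
proof -
  have "cis \<gamma> + cis (- \<gamma>) = of_real (2 * cos \<gamma>)" "cis \<gamma> * cis (- \<gamma>) = 1"
    by (simp_all add: complex_eq_iff cis_mult)
  then show ?thesis
    unfolding ar2_poly_def by (simp add: power2_eq_square) algebra
qed

text \<open>Each of the two linear factors has modulus at least \<open>1 - \<rho>\<close>. In
  particular there is no zero in the closed unit disc, as stationarity demands.\<close>

lemma cmod_ar2_poly_ge:
  assumes "0 < \<rho>" "\<rho> < 1" "cmod z \<le> 1"
  shows "cmod (ar2_poly \<rho> \<gamma> z) \<ge> (1 - \<rho>)\<^sup>2"
proof -
  have "1 - \<rho> \<le> cmod (1 - \<rho> * cis x * z)" for x
  proof -
    have "cmod (\<rho> * cis x * z) \<le> \<rho>" using assms by (simp add: norm_mult mult_left_le)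
    then show ?thesis using norm_triangle_ineq2[of 1 "\<rho> * cis x * z"] by simp
  qed
  then show ?thesis
    unfolding ar2_poly_factor norm_mult power2_eq_square using assms by (intro mult_mono) auto
qed

text \<open>After multiplication by \<open>cis \<omega>\<close> the real part is a multiple of
  \<open>cos \<omega> - cos \<gamma>\<close> up to an error of at most
  \<open>(1 - \<rho>)\<^sup>2\<close>, which the previous bound absorbs. For \<rho> away from 0 this
  bounds the squared difference of cosines divided by the squared modulus.\<close>

lemma cmod_ar2_poly_ge':
  assumes "0 < \<rho>" "\<rho> < 1"
  shows "\<rho> * \<bar>cos \<omega> - cos \<gamma>\<bar> \<le> cmod (ar2_poly \<rho> \<gamma> (cis (- \<omega>)))"
proof -
  let ?p = "cmod (ar2_poly \<rho> \<gamma> (cis (- \<omega>)))"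
  have "cis \<omega> * ar2_poly \<rho> \<gamma> (cis (- \<omega>)) = cis \<omega> - of_real (2 * \<rho> * cos \<gamma>) + of_real (\<rho>\<^sup>2) * cis (- \<omega>)"
  proof -
    have "cis \<omega> * cis (- \<omega>) = 1" by (simp add: cis_mult)
    then show ?thesis unfolding ar2_poly_def by (simp add: power2_eq_square) algebra
  qed
  then have "Re (cis \<omega> * ar2_poly \<rho> \<gamma> (cis (- \<omega>))) = (1 + \<rho>\<^sup>2) * cos \<omega> - 2 * \<rho> * cos \<gamma>"
    by (simp only:) (simp add: distrib_right)
  also have "\<dots> = 2 * \<rho> * (cos \<omega> - cos \<gamma>) + (1 - \<rho>)\<^sup>2 * cos \<omega>"
    by (simp add: power2_eq_square algebra_simps)
  finally have "\<bar>2 * \<rho> * (cos \<omega> - cos \<gamma>) + (1 - \<rho>)\<^sup>2 * cos \<omega>\<bar> \<le> ?p"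
    using abs_Re_le_cmod[of "cis \<omega> * ar2_poly \<rho> \<gamma> (cis (- \<omega>))"] by (simp add: norm_mult)
  moreover have "\<bar>(1 - \<rho>)\<^sup>2 * cos \<omega>\<bar> \<le> (1 - \<rho>)\<^sup>2"
    by (simp add: abs_mult mult_left_le)
  moreover have "(1 - \<rho>)\<^sup>2 \<le> ?p" by (rule cmod_ar2_poly_ge) (use assms in auto)
  ultimately have "\<bar>2 * \<rho> * (cos \<omega> - cos \<gamma>)\<bar> \<le> 2 * ?p" by linarith
  then show ?thesis using assms by (simp add: abs_mult)
qed

text \<open>Near \<gamma> one factor is of order \<open>1 - \<rho>\<close>, while the other is at
  most 2. This makes the peak high enough to dominate the total mass.\<close>

lemma cmod_ar2_poly_le:
  assumes "0 < \<rho>" "\<rho> < 1" "\<bar>\<omega> - \<gamma>\<bar> \<le> 1 - \<rho>"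
  shows "cmod (ar2_poly \<rho> \<gamma> (cis (- \<omega>))) \<le> 4 * (1 - \<rho>)"
proof -
  have "cmod (1 - \<rho> * cis \<gamma> * cis (- \<omega>)) = cmod (of_real (1 - \<rho>) - \<rho> * (cis (\<gamma> - \<omega>) - 1))"
    by (simp add: mult.assoc cis_mult right_diff_distrib)
  also have "\<dots> \<le> (1 - \<rho>) + \<rho> * cmod (cis (\<gamma> - \<omega>) - 1)"
    using norm_triangle_ineq4[of "of_real (1 - \<rho>)" "\<rho> * (cis (\<gamma> - \<omega>) - 1)"] assms
    by (simp add: norm_mult del: of_real_diff)
  also have "\<dots> \<le> (1 - \<rho>) + 1 * (1 - \<rho>)"
    using dist_exp_i_1[of "\<gamma> - \<omega>"] abs_sin_x_le_abs_x[of "(\<gamma> - \<omega>) / 2"] assms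
    by (intro add_left_mono mult_mono) (auto simp: cis_conv_exp)
  finally have "cmod (1 - \<rho> * cis \<gamma> * cis (- \<omega>)) \<le> 2 * (1 - \<rho>)" by simp
  moreover have "cmod (1 - \<rho> * cis (- \<gamma>) * cis (- \<omega>)) \<le> 2"
    using norm_triangle_ineq4[of 1 "\<rho> * cis (- \<gamma>) * cis (- \<omega>)"] assms by (simp add: norm_mult)
  ultimately have "cmod (1 - \<rho> * cis \<gamma> * cis (- \<omega>)) * cmod (1 - \<rho> * cis (- \<gamma>) * cis (- \<omega>)) \<le> (2 * (1 - \<rho>)) * 2"
    using assms by (intro mult_mono) auto
  then show ?thesis by (simp add: ar2_poly_factor norm_mult)
qed

text \<open>With \<open>\<delta> = 1 - \<rho>\<close>, the unnormalized density \<open>1 / D\<close>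
  is at least \<open>1 / (16 * \<delta>\<^sup>2)\<close> on an interval of length \<delta>, so its
  mass \<open>I\<close> is at least \<open>1 / (16 * \<delta>)\<close>. Weighted with the squared
  difference of cosines it is bounded by 4. Normalizing therefore leaves a weighted integral of
  order \<delta>.\<close>

lemma AR2_concentrated:
  assumes \<gamma>: "0 < \<gamma>" "\<gamma> < pi" and "\<epsilon> > 0"
  shows "\<exists>f\<in>F_AR2. set_integrable lebesgue {-pi..pi} (\<lambda>\<omega>. (cos \<omega> - cos \<gamma>)\<^sup>2 * f \<omega>) \<and>
    (LINT \<omega>:{-pi..pi}|lebesgue. (cos \<omega> - cos \<gamma>)\<^sup>2 * f \<omega>) \<le> \<epsilon>"
proof -
  \<comment> \<open>The bound 1/2 gives \<open>\<rho> \<ge> 1/2\<close>, the bound \<gamma> keeps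
    the interval from \<open>\<gamma> - \<delta>\<close> to \<gamma> inside the frequency range, and
    the last one makes the final estimate \<open>128 * pi * \<delta>\<close> at most
    \<epsilon>.\<close>
  define \<delta> where "\<delta> = min (1/2) (min \<gamma> (\<epsilon> / (128 * pi)))"
  define \<rho> where "\<rho> = 1 - \<delta>"
  have \<delta>: "0 < \<delta>" "\<delta> \<le> 1/2" "\<delta> \<le> \<gamma>" "128 * pi * \<delta> \<le> \<epsilon>"
  proof -
    have "\<delta> \<le> \<epsilon> / (128 * pi)" by (simp add: \<delta>_def)
    then show "128 * pi * \<delta> \<le> \<epsilon>" by (simp add: field_simps)
  qed (use assms in \<open>auto simp: \<delta>_def\<close>)
  have \<rho>: "0 < \<rho>" "\<rho> < 1" "1/2 \<le> \<rho>" using \<delta> by (auto simp: \<rho>_def)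
  define D where "D \<omega> = (cmod (ar2_poly \<rho> \<gamma> (cis (- \<omega>))))\<^sup>2" for \<omega>
  have ar0: "ar2_poly \<rho> \<gamma> z \<noteq> 0" if "cmod z \<le> 1" for z
    using cmod_ar2_poly_ge[OF \<rho>(1,2) that, of \<gamma>] \<rho> by (auto simp: not_le)
  have D0: "D \<omega> > 0" for \<omega>
    unfolding D_def using ar0[of "cis (- \<omega>)"] by simp
  have Dcont: "continuous_on S D" for S
    unfolding D_def ar2_poly_def by (intro continuous_intros)
  have Deven: "D (- \<omega>) = D \<omega>" for \<omega>
  proof -
    have "ar2_poly \<rho> \<gamma> (cis \<omega>) = cnj (ar2_poly \<rho> \<gamma> (cis (- \<omega>)))"
      by (simp add: ar2_poly_def cis_cnj)
    then show ?thesis by (simp add: D_def)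
  qed
  have int: "set_integrable lebesgue {-pi..pi} (\<lambda>\<omega>. g \<omega> / D \<omega>)" if "continuous_on UNIV g" for g :: "real \<Rightarrow> real"
    using D0 by (intro absolutely_integrable_continuous_real continuous_intros Dcont
        continuous_on_subset[OF that]) (auto simp: less_imp_neq[symmetric] dest: less_imp_neq)
  define I where "I = (LINT \<omega>:{-pi..pi}|lebesgue. 1 / D \<omega>)"
  have cint: "set_integrable lebesgue {a..b} (\<lambda>\<omega>. k)" "(LINT \<omega>:{a..b}|lebesgue. k) = k * (b - a)"
    if "a \<le> b" for a b k :: real
    using that by (auto simp: set_integrable_def set_lebesgue_integral_def)
  have "1 / (16 * \<delta>) = (LINT \<omega>:{\<gamma>-\<delta>..\<gamma>}|lebesgue. 1 / (16 * \<delta>\<^sup>2))"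
    using \<delta> by (subst cint) (auto simp: power2_eq_square)
  also have "\<dots> \<le> (LINT \<omega>:{\<gamma>-\<delta>..\<gamma>}|lebesgue. 1 / D \<omega>)"
  proof (rule set_integral_mono)
    show "set_integrable lebesgue {\<gamma>-\<delta>..\<gamma>} (\<lambda>\<omega>. 1 / D \<omega>)"
      by (rule set_integrable_subset[OF int]) (use \<gamma> \<delta> in auto)
    fix \<omega> assume "\<omega> \<in> {\<gamma>-\<delta>..\<gamma>}"
    then have "cmod (ar2_poly \<rho> \<gamma> (cis (- \<omega>))) \<le> 4 * \<delta>"
      using cmod_ar2_poly_le[OF \<rho>(1,2), of \<omega> \<gamma>] by (simp add: \<rho>_def)
    then have "D \<omega> \<le> (4 * \<delta>)\<^sup>2" unfolding D_def by (rule power_mono) simp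
    then show "1 / (16 * \<delta>\<^sup>2) \<le> 1 / D \<omega>" using D0[of \<omega>] by (simp add: frac_le power_mult_distrib)
  qed (use \<delta> cint in auto)
  also have "\<dots> \<le> I"
    unfolding I_def set_lebesgue_integral_def
  proof (rule integral_mono)
    show "integrable lebesgue (\<lambda>\<omega>. indicator {\<gamma>-\<delta>..\<gamma>} \<omega> *\<^sub>R (1 / D \<omega>))"
      unfolding set_integrable_def[symmetric] by (rule set_integrable_subset[OF int]) (use \<gamma> \<delta> in auto)
    show "integrable lebesgue (\<lambda>\<omega>. indicator {-pi..pi} \<omega> *\<^sub>R (1 / D \<omega>))"
      unfolding set_integrable_def[symmetric] by (rule int) auto
    show "indicator {\<gamma>-\<delta>..\<gamma>} \<omega> *\<^sub>R (1 / D \<omega>) \<le> indicator {-pi..pi} \<omega> *\<^sub>R (1 / D \<omega>)" for \<omega>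
      using \<gamma> \<delta> D0[of \<omega>] by (auto simp: indicator_def less_imp_le)
  qed
  finally have I: "1 / (16 * \<delta>) \<le> I" .
  then have I0: "I > 0" using \<delta> by (meson divide_pos_pos mult_pos_pos order_less_le_trans zero_less_numeral zero_less_one)
  define f where "f = (\<lambda>\<omega>\<in>{-pi..pi}. 1 / D \<omega> / I)"
  have f_cong: "set_integrable lebesgue {-pi..pi} (\<lambda>\<omega>. g \<omega> * f \<omega>)"
      "(LINT \<omega>:{-pi..pi}|lebesgue. g \<omega> * f \<omega>) = (LINT \<omega>:{-pi..pi}|lebesgue. g \<omega> / D \<omega>) / I"
    if g: "continuous_on UNIV g" for g
  proof -
    have e: "indicator {-pi..pi} \<omega> *\<^sub>R (g \<omega> * f \<omega>) = indicator {-pi..pi} \<omega> *\<^sub>R (g \<omega> / D \<omega>) / I" for \<omega>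
      by (auto simp: f_def indicator_def)
    show "set_integrable lebesgue {-pi..pi} (\<lambda>\<omega>. g \<omega> * f \<omega>)"
      using int[OF g] unfolding set_integrable_def e by (rule integrable_divide)
    show "(LINT \<omega>:{-pi..pi}|lebesgue. g \<omega> * f \<omega>) = (LINT \<omega>:{-pi..pi}|lebesgue. g \<omega> / D \<omega>) / I"
      unfolding set_lebesgue_integral_def e by (rule integral_divide_zero)
  qed
  have F: "f \<in> F_all"
    unfolding F_all_def mem_Collect_eq
  proof (intro conjI ballI)
    show "f \<in> {-pi..pi} \<rightarrow>\<^sub>E {0..}"
      using D0 I0 by (auto simp: f_def less_imp_le)
    show "f (- \<omega>) = f \<omega>" if "\<omega> \<in> {-pi..pi}" for \<omega>
      using that by (auto simp: f_def Deven)
    show "set_integrable lebesgue {-pi..pi} f" "(LINT \<omega>:{-pi..pi}|lebesgue. f \<omega>) = 1"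
      using f_cong[of "\<lambda>_. 1"] I0 by (simp_all add: I_def[symmetric])
  qed
  have "f \<in> F_AR2"
    unfolding F_AR2_def mem_Collect_eq
  proof (intro conjI F exI)
    \<comment> \<open>The innovation variance is forced by the normalization: divided by
      \<open>2 * pi\<close> it has to equal \<open>1 / I\<close>.\<close>
    show "2 * pi / I > 0" using I0 by simp
    show "\<forall>z. cmod z \<le> 1 \<longrightarrow> 1 - of_real (2 * \<rho> * cos \<gamma>) * z - of_real (- (\<rho>\<^sup>2)) * z\<^sup>2 \<noteq> 0"
      using ar0 unfolding ar2_poly_def by blast
    have "exp (- \<i> * of_real \<omega>) = cis (- \<omega>)" "exp (- 2 * \<i> * of_real \<omega>) = (cis (- \<omega>))\<^sup>2" for \<omega>
      by (simp_all add: cis_conv_exp exp_double[symmetric] mult_ac)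
    then show "\<forall>\<omega>\<in>{-pi..pi}. f \<omega> = 2 * pi / I / (2 * pi) / (cmod (1 - of_real (2 * \<rho> * cos \<gamma>) * exp (- \<i> * of_real \<omega>) -
       of_real (- (\<rho>\<^sup>2)) * exp (- 2 * \<i> * of_real \<omega>)))\<^sup>2"
      by (simp add: f_def D_def ar2_poly_def)
  qed
  moreover have "(LINT \<omega>:{-pi..pi}|lebesgue. (cos \<omega> - cos \<gamma>)\<^sup>2 / D \<omega>) \<le> (LINT \<omega>:{-pi..pi}|lebesgue. 4)"
  proof (rule set_integral_mono)
    show "set_integrable lebesgue {-pi..pi} (\<lambda>\<omega>. (cos \<omega> - cos \<gamma>)\<^sup>2 / D \<omega>)"
      by (intro int continuous_intros)
    fix \<omega>
    have "1/2 * \<bar>cos \<omega> - cos \<gamma>\<bar> \<le> \<rho> * \<bar>cos \<omega> - cos \<gamma>\<bar>"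
      using \<rho> by (intro mult_right_mono) auto
    also have "\<dots> \<le> cmod (ar2_poly \<rho> \<gamma> (cis (- \<omega>)))" by (rule cmod_ar2_poly_ge'[OF \<rho>(1,2)])
    finally have "(1/2 * \<bar>cos \<omega> - cos \<gamma>\<bar>)\<^sup>2 \<le> D \<omega>" unfolding D_def by (rule power_mono) simp
    then show "(cos \<omega> - cos \<gamma>)\<^sup>2 / D \<omega> \<le> 4" using D0[of \<omega>] by (simp add: field_simps power2_eq_square)
  qed (use cint in auto)
  then have "(LINT \<omega>:{-pi..pi}|lebesgue. (cos \<omega> - cos \<gamma>)\<^sup>2 * f \<omega>) \<le> 8 * pi / I"
    using I0 by (subst f_cong) (auto intro!: continuous_intros divide_right_mono simp: cint)
  moreover have "8 * pi / I \<le> \<epsilon>"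
  proof -
    have "8 * pi / I \<le> 8 * pi / (1 / (16 * \<delta>))"
      using I I0 \<delta> by (intro divide_left_mono) auto
    also have "\<dots> = 128 * pi * \<delta>" by simp
    finally show ?thesis using \<delta>(4) by linarith
  qed
  moreover have "set_integrable lebesgue {-pi..pi} (\<lambda>\<omega>. (cos \<omega> - cos \<gamma>)\<^sup>2 * f \<omega>)"
    by (intro f_cong continuous_intros)
  ultimately show ?thesis by force
qed

text \<open>The autocovariances are integrals of \<open>cos (h * \<omega>)\<close> with integer lags
  \<open>h\<close>. They differ from \<open>cos (h * \<gamma>)\<close> by at most a constant times
  the first absolute moment of \<open>cos \<omega> - cos \<gamma>\<close>, which its second moment
  controls.\<close>

lemma Sigma_spec_AR2_limit:
  fixes t :: "'n::finite \<Rightarrow> nat"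
  assumes \<gamma>: "0 < \<gamma>" "\<gamma> < pi"
  shows "\<exists>f. (\<forall>m. f m \<in> F_AR2) \<and>
    (\<forall>j l. (\<lambda>m. Sigma_spec t (f m) $ j $ l) \<longlonglongrightarrow> cos ((real (t j) - real (t l)) * \<gamma>))"
proof -
  define x where "x \<omega> = cos \<omega> - cos \<gamma>" for \<omega>
  have "\<forall>m. \<exists>f. f \<in> F_AR2 \<and> set_integrable lebesgue {-pi..pi} (\<lambda>\<omega>. (x \<omega>)\<^sup>2 * f \<omega>) \<and>
    (LINT \<omega>:{-pi..pi}|lebesgue. (x \<omega>)\<^sup>2 * f \<omega>) \<le> (1 / real (Suc m))\<^sup>2"
    using AR2_concentrated[OF \<gamma>] unfolding x_def Bex_def by simp
  from choice[OF this] obtain f where f: "\<And>m. f m \<in> F_AR2"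
    and fi: "\<And>m. set_integrable lebesgue {-pi..pi} (\<lambda>\<omega>. (x \<omega>)\<^sup>2 * f m \<omega>)"
    and fl: "\<And>m. (LINT \<omega>:{-pi..pi}|lebesgue. (x \<omega>)\<^sup>2 * f m \<omega>) \<le> (1 / real (Suc m))\<^sup>2"
    by blast
  have "(\<lambda>m. Sigma_spec t (f m) $ j $ l) \<longlonglongrightarrow> cos ((real (t j) - real (t l)) * \<gamma>)" for j l
  proof -
    define h where "h = real (t j) - real (t l)"
    define n where "n = nat \<bar>int (t j) - int (t l)\<bar>"
    have n: "\<bar>h\<bar> = real n" by (simp add: h_def n_def)
    have cosh: "cos (h * \<omega>) = cos (real n * \<omega>)" for \<omega>
      using n by (metis abs_mult abs_of_nat cos_abs_real abs_abs)
    have bound: "norm (Sigma_spec t (f m) $ j $ l - cos (h * \<gamma>)) \<le> 2 * (real n)\<^sup>2 * (1 / real (Suc m))" for m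
    proof -
      \<comment> \<open>The square of \<eta> bounds the second moment. In place of the
        Cauchy-Schwarz inequality, the pointwise bound of the absolute value of
        \<open>x \<omega>\<close> by \<open>\<eta> + inverse \<eta> * (x \<omega>)\<^sup>2\<close>
        is integrated, which gives at most \<open>2 * \<eta>\<close>.\<close>
      define \<eta> where "\<eta> = 1 / real (Suc m)"
      have \<eta>: "\<eta> > 0" by (simp add: \<eta>_def)
      have F: "f m \<in> F_all" using f[of m] by (simp add: F_AR2_def)
      have f0: "0 \<le> f m \<omega>" if "\<omega> \<in> {-pi..pi}" for \<omega>
        using F that by (auto simp: F_all_def PiE_iff)
      have fint: "set_integrable lebesgue {-pi..pi} (f m)" "(LINT \<omega>:{-pi..pi}|lebesgue. f m \<omega>) = 1"
        using F by (auto simp: F_all_def)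
      note ci = Sigma_spec_sym(3)[OF F, of t j l, folded h_def]
      let ?u = "\<lambda>\<omega>. cos (h * \<omega>) * f m \<omega> - cos (h * \<gamma>) * f m \<omega>"
      let ?w = "\<lambda>\<omega>. (real n)\<^sup>2 * (\<eta> * f m \<omega> + inverse \<eta> * ((x \<omega>)\<^sup>2 * f m \<omega>))"
      have ui: "set_integrable lebesgue {-pi..pi} ?u"
        by (intro set_integral_diff set_integrable_mult_right impI ci fint)
      have wi: "set_integrable lebesgue {-pi..pi} ?w"
        by (intro set_integral_add set_integrable_mult_right impI fi fint)
      have u: "(LINT \<omega>:{-pi..pi}|lebesgue. ?u \<omega>) = Sigma_spec t (f m) $ j $ l - cos (h * \<gamma>)"
        using ci fint by (subst set_integral_diff) (auto simp: Sigma_spec_sym(2)[OF F] h_def)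
      have "(LINT \<omega>:{-pi..pi}|lebesgue. ?w \<omega>)
          = (real n)\<^sup>2 * (\<eta> + inverse \<eta> * (LINT \<omega>:{-pi..pi}|lebesgue. (x \<omega>)\<^sup>2 * f m \<omega>))"
        using fi fint by (simp add: set_integral_add(2))
      also have "\<dots> \<le> (real n)\<^sup>2 * (\<eta> + inverse \<eta> * \<eta>\<^sup>2)"
        using fl[of m] \<eta> by (intro mult_left_mono add_left_mono) (auto simp: \<eta>_def)
      also have "\<dots> = 2 * (real n)\<^sup>2 * \<eta>" using \<eta> by (simp add: power2_eq_square)
      finally have w: "(LINT \<omega>:{-pi..pi}|lebesgue. ?w \<omega>) \<le> 2 * (real n)\<^sup>2 * \<eta>" .
      have le: "\<bar>?u \<omega>\<bar> \<le> ?w \<omega>" if "\<omega> \<in> {-pi..pi}" for \<omega>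
      proof -
        have "\<bar>x \<omega>\<bar> \<le> \<eta> + inverse \<eta> * (x \<omega>)\<^sup>2"
        proof (cases "\<bar>x \<omega>\<bar> \<le> \<eta>")
          case False
          then have "\<eta> * \<bar>x \<omega>\<bar> \<le> \<bar>x \<omega>\<bar> * \<bar>x \<omega>\<bar>" by (intro mult_right_mono) auto
          then have "\<bar>x \<omega>\<bar> \<le> inverse \<eta> * (x \<omega>)\<^sup>2" using \<eta> by (simp add: field_simps power2_eq_square)
          then show ?thesis using \<eta> by simp
        qed (use \<eta> in \<open>simp add: add_increasing2\<close>)
        then have "\<bar>cos (h * \<omega>) - cos (h * \<gamma>)\<bar> \<le> (real n)\<^sup>2 * (\<eta> + inverse \<eta> * (x \<omega>)\<^sup>2)"
          using cos_nat_mult_diff_le[of n \<omega> \<gamma>] unfolding cosh x_def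
          by (meson mult_left_mono order_trans zero_le_power2)
        then have "\<bar>cos (h * \<omega>) - cos (h * \<gamma>)\<bar> * f m \<omega> \<le> (real n)\<^sup>2 * (\<eta> + inverse \<eta> * (x \<omega>)\<^sup>2) * f m \<omega>"
          by (rule mult_right_mono) (rule f0[OF that])
        also have "\<dots> = ?w \<omega>" by (simp add: algebra_simps)
        also have "\<bar>cos (h * \<omega>) - cos (h * \<gamma>)\<bar> * f m \<omega> = \<bar>(cos (h * \<omega>) - cos (h * \<gamma>)) * f m \<omega>\<bar>"
          using f0[OF that] by (simp add: abs_mult)
        finally show ?thesis by (simp only: left_diff_distrib)
      qed
      have "(LINT \<omega>:{-pi..pi}|lebesgue. ?u \<omega>) \<le> (LINT \<omega>:{-pi..pi}|lebesgue. ?w \<omega>)"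
        by (rule set_integral_mono[OF ui wi]) (use le in fastforce)
      moreover have "(LINT \<omega>:{-pi..pi}|lebesgue. - ?u \<omega>) \<le> (LINT \<omega>:{-pi..pi}|lebesgue. ?w \<omega>)"
      proof (rule set_integral_mono[OF _ wi])
        show "set_integrable lebesgue {-pi..pi} (\<lambda>\<omega>. - ?u \<omega>)"
          using ui unfolding set_integrable_def scaleR_minus_right by (rule integrable_minus)
        show "- ?u \<omega> \<le> ?w \<omega>" if "\<omega> \<in> {-pi..pi}" for \<omega> using le[OF that] by linarith
      qed
      moreover have "(LINT \<omega>:{-pi..pi}|lebesgue. - ?u \<omega>) = - (LINT \<omega>:{-pi..pi}|lebesgue. ?u \<omega>)"
        by (simp only: set_lebesgue_integral_def scaleR_minus_right integral_minus)
      ultimately show ?thesis using u w unfolding \<eta>_def real_norm_def by linarith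
    qed
    have "(\<lambda>m. 2 * (real n)\<^sup>2 * (1 / real (Suc m))) \<longlonglongrightarrow> 2 * (real n)\<^sup>2 * 0"
      by (intro tendsto_intros LIMSEQ_Suc lim_1_over_n)
    then have "(\<lambda>m. Sigma_spec t (f m) $ j $ l - cos (h * \<gamma>)) \<longlonglongrightarrow> 0"
      by (intro Lim_null_comparison[OF always_eventually[OF allI[OF bound]]]) simp
    then show ?thesis unfolding h_def by (simp add: LIM_zero_iff)
  qed
  then show ?thesis using f by blast
qed

section \<open>Mixtures with white noise\<close>

lemma integral_cos_int_mult:
  assumes "h \<in> \<int>"
  shows "(LINT \<omega>:{-pi..pi}|lebesgue. cos (h * \<omega>)) = (if h = 0 then 2 * pi else 0)"
proof (cases "h = 0")
  case True
  then show ?thesis by (simp add: set_lebesgue_integral_def)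
next
  case False
  have "((\<lambda>\<omega>. cos (h * \<omega>)) has_integral (sin (h * pi) / h - sin (h * - pi) / h)) {-pi..pi}"
    by (rule fundamental_theorem_of_calculus)
       (use False in \<open>auto intro!: derivative_eq_intros simp flip: has_real_derivative_iff_has_vector_derivative\<close>)
  moreover have "sin (h * pi) = 0" using assms by (metis mult.commute sin_integer_2pi sin_times_pi_eq_0)
  ultimately have "integral {-pi..pi} (\<lambda>\<omega>. cos (h * \<omega>)) = 0"
    by (auto dest: integral_unique)
  moreover have "set_integrable lebesgue {-pi..pi} (\<lambda>\<omega>. cos (h * \<omega>))"
    by (intro absolutely_integrable_continuous_real continuous_intros)
  ultimately show ?thesis using False by (simp add: set_lebesgue_integral_eq_integral)
qed

text \<open>The constant density contributes the identity matrix: distinct indices have a nonzero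
  integer lag, over which the cosine integrates to zero.\<close>

lemma Sigma_spec_mixture:
  fixes t :: "'n::finite \<Rightarrow> nat"
  assumes f: "f \<in> F_all" and g: "g \<in> F_all" and t: "inj t"
    and eq: "g = (\<lambda>\<omega>\<in>{-pi..pi}. c1 * f \<omega> + c2 / (2 * pi))"
  shows "Sigma_spec t g = c1 *\<^sub>R Sigma_spec t f + c2 *\<^sub>R mat 1"
proof -
  have "Sigma_spec t g $ j $ l = c1 * Sigma_spec t f $ j $ l + c2 * mat 1 $ j $ l" for j l
  proof -
    let ?h = "real (t j) - real (t l)"
    note fi = Sigma_spec_sym(3)[OF f, of t j l]
    have ci: "set_integrable lebesgue {-pi..pi} (\<lambda>\<omega>. cos (?h * \<omega>))"
      by (intro absolutely_integrable_continuous_real continuous_intros)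
    have "Sigma_spec t g $ j $ l = (LINT \<omega>:{-pi..pi}|lebesgue. c1 * (cos (?h * \<omega>) * f \<omega>) + c2 / (2 * pi) * cos (?h * \<omega>))"
      unfolding Sigma_spec_sym(2)[OF g] set_lebesgue_integral_def
      by (rule Bochner_Integration.integral_cong) (auto simp: eq indicator_def algebra_simps)
    also have "\<dots> = c1 * (LINT \<omega>:{-pi..pi}|lebesgue. cos (?h * \<omega>) * f \<omega>) + c2 / (2 * pi) * (LINT \<omega>:{-pi..pi}|lebesgue. cos (?h * \<omega>))"
      using fi ci by (subst set_integral_add) auto
    also have "(LINT \<omega>:{-pi..pi}|lebesgue. cos (?h * \<omega>)) = (if j = l then 2 * pi else 0)"
      using t by (subst integral_cos_int_mult) (auto simp: inj_eq)
    finally show ?thesis by (simp add: Sigma_spec_sym(2)[OF f] mat_def)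
  qed
  then show ?thesis by (simp add: vec_eq_iff)
qed

section \<open>The regression model\<close>

lemma pos_def_matrix_inv:
  fixes V :: "real^'n^'n"
  assumes V: "\<And>z. z \<noteq> 0 \<Longrightarrow> z \<bullet> (V *v z) > 0" and "z \<noteq> 0"
  shows "z \<bullet> (matrix_inv V *v z) > 0"
proof -
  let ?x = "matrix_inv V *v z"
  have x: "V *v ?x = z"
    by (simp add: matrix_vector_mul_assoc matrix_inv_inverse(1)[OF pos_def_imp_invertible[OF V]])
  then have "?x \<noteq> 0" using \<open>z \<noteq> 0\<close> by auto
  from V[OF this] show ?thesis by (simp add: x inner_commute)
qed

lemma transpose_matrix_inv:
  fixes A :: "real^'n^'n"
  assumes "invertible A"
  shows "transpose (matrix_inv A) = matrix_inv (transpose A)"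
  by (rule matrix_inv_eqI[symmetric])
     (metis assms matrix_inv_inverse(2) matrix_transpose_mul transpose_mat)

lemma inner_transpose_mult: "x \<bullet> (transpose A *v y) = (A *v x) \<bullet> y" for A :: "real^'n^'m"
  by (metis dot_lmul_matrix inner_commute transpose_matrix_vector)

lemma finite_line_solutions:
  fixes w :: "'a::real_vector"
  assumes "w \<noteq> 0"
  shows "finite {\<tau>. x + \<tau> *\<^sub>R w = y}"
proof -
  have "\<tau> = \<tau>'" if "x + \<tau> *\<^sub>R w = y" "x + \<tau>' *\<^sub>R w = y" for \<tau> \<tau>'
    using that assms by (metis add_left_cancel scaleR_right_imp_eq)
  then have "\<exists>\<tau>\<^sub>0. {\<tau>. x + \<tau> *\<^sub>R w = y} \<subseteq> {\<tau>\<^sub>0}" by blast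
  then show ?thesis by (meson finite.emptyI finite_insert finite_subset)
qed

lemma finite_quadratic_zeros:
  fixes a b c :: real
  assumes "c \<noteq> 0"
  shows "finite {\<tau>. a + \<tau> * b + \<tau>\<^sup>2 * c = 0}"
proof -
  have "finite {\<tau>. poly [:a, b, c:] \<tau> = 0}"
    using assms by (intro poly_roots_finite) simp
  then show ?thesis by (simp add: algebra_simps power2_eq_square)
qed

text \<open>Prepares the use of \<open>null_set_if_finite_lines\<close>: a direction
  \<open>v\<close> with nonzero leading coefficient leaves finitely many zeros on each line.\<close>

lemma omega_hat_lines:
  fixes X :: "real^'k^'n"
  assumes lin: "linear (u_hat X)"
  shows "omega_hat X W (x + \<tau> *\<^sub>R v) = omega_hat X W x
    + \<tau> * ((u_hat X x \<bullet> (W *v u_hat X v) + u_hat X v \<bullet> (W *v u_hat X x)) / real CARD('n))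
    + \<tau>\<^sup>2 * omega_hat X W v"
  unfolding omega_hat_def linear_add[OF lin] linear_scale[OF lin]
  by (simp add: matrix_vector_right_distrib matrix_vector_mult_scaleR inner_add_left inner_add_right
      power2_eq_square add_divide_distrib distrib_left)

locale regression =
  fixes X :: "real^'k^'n" and R :: "real^'k^'q"
  assumes rank_X: "rank X = CARD('k)" and rank_R: "rank R = CARD('q)"
begin

text \<open>The covariance matrix of \<open>Rb y\<close> when the errors are uncorrelated with
  variance one.\<close>

definition M :: "real^'q^'q" where "M = R ** matrix_inv (transpose X ** X) ** transpose R"

definition Rb :: "real^'n \<Rightarrow> real^'q" where "Rb y = R *v beta_hat X y"

lemma X_eq_0: "X *v b = 0 \<longleftrightarrow> b = 0"
  using rank_X by (metis full_rank_injective injD matrix_vector_mult_0_right)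

lemma surj_R: "surj ((*v) R)"
  using rank_R by (simp add: full_rank_surjective)

lemma XX_pos_def: "b \<noteq> 0 \<Longrightarrow> b \<bullet> ((transpose X ** X) *v b) > 0"
  by (simp add: X_eq_0 inner_transpose_mult del: transpose_matrix_vector flip: matrix_vector_mul_assoc)

lemmas XX_inverse = matrix_inv_inverse[OF pos_def_imp_invertible[OF XX_pos_def]]

text \<open>Since \<open>R\<close> is onto, its transpose is injective, so positive definiteness
  passes from the inverse of \<open>transpose X ** X\<close> to \<open>M\<close>.\<close>

lemma M_pos_def: "z \<noteq> 0 \<Longrightarrow> z \<bullet> (M *v z) > 0"
proof -
  assume "z \<noteq> 0"
  obtain b where b: "z = R *v b" using surj_R by (metis surjD)
  have "transpose R *v z \<noteq> 0"
  proof
    assume "transpose R *v z = 0"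
    then have "z \<bullet> z = 0" using inner_transpose_mult[of b R z] b by simp
    then show False using \<open>z \<noteq> 0\<close> by simp
  qed
  from pos_def_matrix_inv[OF XX_pos_def this] show ?thesis
    unfolding M_def matrix_vector_mul_assoc[symmetric]
    by (metis inner_commute inner_transpose_mult)
qed

lemma transpose_M: "transpose M = M"
proof -
  have "transpose (matrix_inv (transpose X ** X)) = matrix_inv (transpose X ** X)"
    by (simp add: transpose_matrix_inv pos_def_imp_invertible[OF XX_pos_def] matrix_transpose_mul)
  then show ?thesis by (simp add: M_def matrix_transpose_mul matrix_mul_assoc)
qed

section \<open>Least squares estimator and residuals\<close>

lemma beta_hat_matrix: "beta_hat X = (*v) (matrix_inv (transpose X ** X) ** transpose X)"
  by (simp add: fun_eq_iff beta_hat_def matrix_vector_mul_assoc del: transpose_matrix_vector)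

lemma beta_hat_X: "beta_hat X (X *v b) = b"
  unfolding beta_hat_matrix
  by (simp add: matrix_vector_mul_assoc matrix_mul_assoc[symmetric] XX_inverse)

lemma linear_beta_hat: "linear (beta_hat X)"
  unfolding beta_hat_matrix by simp

lemma linear_u_hat: "linear (u_hat X)"
  unfolding u_hat_def by (intro linear_compose_sub linear_compose[OF linear_beta_hat, unfolded o_def])
    (simp_all add: linear_id[unfolded id_def])

lemma linear_Rb: "linear Rb"
  unfolding Rb_def by (intro linear_compose[OF linear_beta_hat, unfolded o_def]) simp

lemma continuous_model [continuous_intros]:
  "continuous_on S (beta_hat X)" "continuous_on S (u_hat X)" "continuous_on S Rb"
  by (intro linear_continuous_on linear_conv_bounded_linear[THEN iffD1] linear_beta_hat linear_u_hat linear_Rb)+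

lemma continuous_omega_hat: "continuous_on S (omega_hat X W)"
  unfolding omega_hat_def
  by (intro continuous_intros continuous_on_compose2[OF linear_continuous_on[OF matrix_vector_mul_bounded_linear]])
     auto

lemma measurable_model [measurable]:
  "omega_hat X W \<in> borel_measurable borel" "Rb \<in> borel_measurable borel"
  by (intro borel_measurable_continuous_onI continuous_omega_hat continuous_model)+

lemma u_hat_X: "u_hat X (X *v b) = 0"
  by (simp add: u_hat_def beta_hat_X)

lemma u_hat_orthogonal: "(X *v b) \<bullet> u_hat X y = 0"
proof -
  have "transpose X *v u_hat X y = transpose X *v y - ((transpose X ** X) ** matrix_inv (transpose X ** X)) *v (transpose X *v y)"
    by (simp add: u_hat_def beta_hat_def matrix_vector_mult_diff_distrib matrix_vector_mul_assoc
        matrix_mul_assoc del: transpose_matrix_vector)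
  then have "transpose X *v u_hat X y = 0"
    by (simp add: XX_inverse)
  then show ?thesis by (simp add: inner_transpose_mult[symmetric] del: transpose_matrix_vector)
qed

lemma omega_hat_equivariant: "omega_hat X W (\<delta> *\<^sub>R y + X *v \<eta>) = \<delta>\<^sup>2 * omega_hat X W y"
  by (simp add: omega_hat_def linear_add[OF linear_u_hat] linear_scale[OF linear_u_hat] u_hat_X
      matrix_vector_mult_scaleR power2_eq_square)

lemma beta_hat_equivariant: "beta_hat X (\<delta> *\<^sub>R y + X *v \<eta>) = \<delta> *\<^sub>R beta_hat X y + \<eta>"
  by (simp add: linear_add[OF linear_beta_hat] linear_scale[OF linear_beta_hat] beta_hat_X)

text \<open>The definite description asks for a remainder in the double complement of the column
  space, which contains the fitted values. It is unique because the difference of two candidates is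
  orthogonal to itself.\<close>

lemma proj_matrix_residual: "proj_matrix ((span (columns X))\<^sup>\<bottom>) *v y = u_hat X y"
proof -
  let ?S = "span (columns X)"
  have orth: "u_hat X y \<in> ?S\<^sup>\<bottom>" for y
  proof -
    have "orthogonal (u_hat X y) z" if "z \<in> columns X" for z
    proof -
      from that obtain b where "z = X *v b" by (auto simp: columns_image_basis)
      then show ?thesis using u_hat_orthogonal by (simp add: orthogonal_def inner_commute)
    qed
    then have "orthogonal (u_hat X y) z" if "z \<in> ?S" for z
      using orthogonal_to_span that by blast
    then show ?thesis by (simp add: orthogonal_comp_def orthogonal_commute)
  qed
  have mem: "y - u_hat X y \<in> ?S\<^sup>\<bottom>\<^sup>\<bottom>" for y
    using orthogonal_comp_subset[of ?S] matrix_vector_mult_in_columnspace[of X "beta_hat X y"]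
    by (auto simp: u_hat_def)
  have "(THE p. p \<in> ?S\<^sup>\<bottom> \<and> y - p \<in> ?S\<^sup>\<bottom>\<^sup>\<bottom>) = u_hat X y" for y
  proof (rule the_equality)
    fix p assume p: "p \<in> ?S\<^sup>\<bottom> \<and> y - p \<in> ?S\<^sup>\<bottom>\<^sup>\<bottom>"
    have "p - u_hat X y \<in> ?S\<^sup>\<bottom>"
      using p orth subspace_orthogonal_comp subspace_diff by blast
    moreover have "(y - u_hat X y) - (y - p) \<in> ?S\<^sup>\<bottom>\<^sup>\<bottom>"
      using p mem subspace_orthogonal_comp subspace_diff by blast
    then have "p - u_hat X y \<in> ?S\<^sup>\<bottom>\<^sup>\<bottom>" by simp
    ultimately have "orthogonal (p - u_hat X y) (p - u_hat X y)"
      by (auto simp: orthogonal_comp_def[of "?S\<^sup>\<bottom>"] orthogonal_commute)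
    then show "p = u_hat X y" by (simp add: orthogonal_self)
  qed (use orth mem in blast)
  then show ?thesis unfolding proj_matrix_def by (simp add: matrix_works linear_u_hat)
qed

text \<open>By polarization, a symmetric form in the residuals that vanishes on the diagonal
  vanishes altogether. Then the residual part of \<open>W *v u_hat X y\<close> is orthogonal to
  itself, and the projected matrix would be zero.\<close>

lemma omega_hat_nontrivial:
  assumes W: "transpose W = W"
    and nz: "proj_matrix ((span (columns X))\<^sup>\<bottom>) ** W ** proj_matrix ((span (columns X))\<^sup>\<bottom>) \<noteq> 0"
  shows "\<exists>v. omega_hat X W v \<noteq> 0"
proof (rule ccontr)
  assume "\<not> ?thesis"
  then have 0: "u_hat X v \<bullet> (W *v u_hat X v) = 0" for v by (simp add: omega_hat_def)
  have B0: "u_hat X x \<bullet> (W *v u_hat X y) = 0" for x y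
  proof -
    have "u_hat X y \<bullet> (W *v u_hat X x) = u_hat X x \<bullet> (W *v u_hat X y)"
      by (metis W inner_commute inner_transpose_mult)
    then show ?thesis
      using 0[of "x + y"] 0[of x] 0[of y]
      by (simp add: linear_add[OF linear_u_hat] matrix_vector_right_distrib inner_add_left inner_add_right)
  qed
  let ?P = "proj_matrix ((span (columns X))\<^sup>\<bottom>)"
  have "(?P ** W ** ?P) *v y = 0" for y
  proof -
    let ?z = "W *v u_hat X y"
    have "u_hat X ?z \<bullet> u_hat X ?z = u_hat X ?z \<bullet> ?z"
      using u_hat_orthogonal[of "beta_hat X ?z" ?z]
      by (subst (2) u_hat_def) (simp add: inner_diff_right inner_commute)
    then have "u_hat X ?z = 0" using B0 by simp
    then show ?thesis by (simp add: matrix_vector_mul_assoc[symmetric] proj_matrix_residual)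
  qed
  then have "?P ** W ** ?P = 0" by (simp add: matrix_eq)
  with nz show False by contradiction
qed

lemma AE_omega_hat_nonzero:
  assumes "\<exists>v. omega_hat X W v \<noteq> 0"
  shows "AE y in lborel. omega_hat X W y \<noteq> 0"
proof -
  obtain v where v: "omega_hat X W v \<noteq> 0" using assms by blast
  have "{y. omega_hat X W y = 0} \<in> null_sets lborel"
  proof (rule null_set_if_finite_lines)
    show "finite {\<tau>. x + \<tau> *\<^sub>R v \<in> {y. omega_hat X W y = 0}}" for x
      unfolding mem_Collect_eq omega_hat_lines[OF linear_u_hat] by (rule finite_quadratic_zeros[OF v])
  qed measurable
  from AE_not_in[OF this] show ?thesis by simp
qed

lemma AE_Rb_neq: "AE y in lborel. Rb y \<noteq> r"
proof -
  \<comment> \<open>Moving along \<open>X *v b\<close> moves \<open>Rb\<close> along the all-ones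
    vector, so each such line meets the set at most once.\<close>
  obtain b where b: "R *v b = 1" using surj_R by (metis surjD)
  have b1: "(1 :: real^'q) \<noteq> 0" by (simp add: vec_eq_iff)
  have "{y. Rb y = r} \<in> null_sets lborel"
  proof (rule null_set_if_finite_lines)
    show "finite {\<tau>. x + \<tau> *\<^sub>R (X *v b) \<in> {y. Rb y = r}}" for x
      using finite_line_solutions[OF b1, of "Rb x" r]
      by (simp add: linear_add[OF linear_Rb] linear_scale[OF linear_Rb] Rb_def[of "X *v b"] beta_hat_X b)
  qed measurable
  from AE_not_in[OF this] show ?thesis by simp
qed

section \<open>The test statistic and its invariance\<close>

lemma Omega_W_eq: "Omega_W X R W y = omega_hat X W y *\<^sub>R M"
  by (simp add: Omega_W_def M_def)

lemma scaled_M_inverse: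
  assumes "c \<noteq> 0"
  shows "matrix_inv (c *\<^sub>R M) = inverse c *\<^sub>R matrix_inv M" "invertible (c *\<^sub>R M)"
proof -
  have "(c *\<^sub>R M) ** (inverse c *\<^sub>R matrix_inv M) = mat 1"
    using assms matrix_inv_inverse(1)[OF pos_def_imp_invertible[OF M_pos_def]]
    by (simp add: matrix_scalar_ac flip: scalar_matrix_assoc)
  then show "matrix_inv (c *\<^sub>R M) = inverse c *\<^sub>R matrix_inv M" "invertible (c *\<^sub>R M)"
    by (auto intro: matrix_inv_eqI simp: invertible_right_inverse)
qed

lemma det_Omega_W: "det (Omega_W X R W y) = 0 \<longleftrightarrow> omega_hat X W y = 0"
proof (cases "omega_hat X W y = 0")
  case True
  \<comment> \<open>Here \<open>undefined\<close> serves as an arbitrary row index.\<close>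
  have "row undefined (0 :: real^'q^'q) = 0" by (simp add: row_def vec_eq_iff)
  then show ?thesis using True det_zero_row by (auto simp: Omega_W_eq)
next
  case False
  then show ?thesis using scaled_M_inverse(2)[OF False] by (simp add: Omega_W_eq invertible_det_nz)
qed

text \<open>As \<open>M\<close> is nonsingular, the exceptional set is the zero set of the variance
  estimator. Off that set the numerator is a positive definite form in \<open>Rb y - r\<close>, so
  only the denominator can make the statistic negative.\<close>

lemma F_type_stat_eq:
  "F_type_stat R r (beta_hat X) (Omega_W X R W) {} y =
    (if omega_hat X W y = 0 then 0
     else ((Rb y - r) \<bullet> (matrix_inv M *v (Rb y - r))) / omega_hat X W y)"
  unfolding F_type_stat_def N_star_def det_Omega_W
  by (simp add: Omega_W_eq scaled_M_inverse Rb_def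
      scaleR_matrix_vector_assoc[symmetric] divide_inverse mult.commute)

lemma measurable_F_type_stat [measurable]:
  "F_type_stat R r (beta_hat X) (Omega_W X R W) {} \<in> borel_measurable borel"
  unfolding F_type_stat_eq[abs_def] by measurable

text \<open>A mean in \<open>M0\<close> shifts \<open>Rb\<close> by exactly \<open>r\<close> and
  leaves the residuals alone, and the scale cancels since numerator and denominator are both
  quadratic. Null probabilities thus reduce to mean zero, \<open>r = 0\<close>, and covariance
  matrices up to a positive factor.\<close>

lemma F_type_stat_invariant:
  assumes "s > 0" "\<mu> \<in> M0 X R r"
  shows "F_type_stat R r (beta_hat X) (Omega_W X R W) {} (\<mu> + s *\<^sub>R z)
    = F_type_stat R 0 (beta_hat X) (Omega_W X R W) {} z"
proof -
  obtain b where b: "\<mu> = X *v b" "R *v b = r" using assms by (auto simp: M0_def)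
  have "Rb (\<mu> + s *\<^sub>R z) - r = s *\<^sub>R Rb z"
    by (simp add: linear_add[OF linear_Rb] linear_scale[OF linear_Rb] b Rb_def[of "X *v b"] beta_hat_X)
  moreover have "omega_hat X W (\<mu> + s *\<^sub>R z) = s\<^sup>2 * omega_hat X W z"
    using omega_hat_equivariant[of W s z b] by (simp add: b add.commute)
  ultimately show ?thesis
    using \<open>s > 0\<close> by (simp add: F_type_stat_eq matrix_vector_mult_scaleR power2_eq_square)
qed

lemma estimator_conditions_hold:
  assumes "\<exists>v. omega_hat X W v \<noteq> 0"
  shows "estimator_conditions X (beta_hat X) (Omega_W X R W) {}"
  unfolding estimator_conditions_def
proof (intro conjI allI impI)
  show "continuous_on (- {}) (Omega_W X R W)"
    unfolding Omega_W_eq[abs_def] by (intro continuous_intros continuous_omega_hat)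
  show "AE y in lborel. y \<notin> {} \<longrightarrow> invertible (Omega_W X R W y)"
    using AE_omega_hat_nonzero[OF assms] by eventually_elim (simp add: invertible_det_nz det_Omega_W)
qed (simp_all add: continuous_model transpose_scalar transpose_M Omega_W_eq omega_hat_equivariant beta_hat_equivariant)

lemma alternative_bound:
  assumes W: "\<exists>v. omega_hat X W v \<noteq> 0" and "C \<ge> 0" "\<mu> \<in> M1 X R r" "\<sigma>2 > 0"
  shows "emeasure (gaussian \<mu> (\<sigma>2 *\<^sub>R mat 1)) {y. F_type_stat R r (beta_hat X) (Omega_W X R W) {} y \<ge> C}
    \<le> emeasure (gaussian 0 (mat 1)) {y. omega_hat X W y \<ge> 0}"
proof -
  obtain b where b: "\<mu> = X *v b" using assms by (auto simp: M1_def)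
  define s where "s = sqrt \<sigma>2"
  have s: "s > 0" "\<sigma>2 = s\<^sup>2" using \<open>\<sigma>2 > 0\<close> by (auto simp: s_def)
  \<comment> \<open>Off the null set where \<open>Rb y = r\<close> the numerator is positive, so a
    negative variance estimate would give a negative statistic, below \<open>C\<close>.\<close>
  have "AE y in lborel. F_type_stat R r (beta_hat X) (Omega_W X R W) {} y \<ge> C \<longrightarrow> omega_hat X W y \<ge> 0"
    using AE_Rb_neq[of r]
  proof eventually_elim
    case (elim y)
    then have "(Rb y - r) \<bullet> (matrix_inv M *v (Rb y - r)) > 0"
      by (intro pos_def_matrix_inv M_pos_def) auto
    then show ?case using \<open>C \<ge> 0\<close>
      by (auto simp: F_type_stat_eq zero_le_divide_iff dest: order_trans)
  qed
  then have "emeasure (gaussian \<mu> (\<sigma>2 *\<^sub>R mat 1)) {y. F_type_stat R r (beta_hat X) (Omega_W X R W) {} y \<ge> C}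
      \<le> emeasure (gaussian \<mu> (\<sigma>2 *\<^sub>R mat 1)) {y. omega_hat X W y \<ge> 0}"
    by (intro emeasure_mono_AE AE_gaussian) auto
  also have "\<dots> = emeasure (gaussian 0 (mat 1)) {z. omega_hat X W (\<mu> + s *\<^sub>R z) \<ge> 0}"
    unfolding s by (subst emeasure_gaussian_scale[OF s(1)]) (simp_all add: invertible_right_inverse)
  also have "{z. omega_hat X W (\<mu> + s *\<^sub>R z) \<ge> 0} = {z. omega_hat X W z \<ge> 0}"
    using omega_hat_equivariant[of W s _ b] s by (simp add: b add.commute zero_le_mult_iff)
  finally show ?thesis .
qed

end

section \<open>A square root of a rank-two perturbation of the identity\<close>

definition outer :: "real^'n \<Rightarrow> real^'n \<Rightarrow> real^'n^'n" where
  "outer a b = (\<chi> i j. a $ i * b $ j)"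

lemma outer_mult: "outer a b *v z = (b \<bullet> z) *\<^sub>R a"
  by (simp add: vec_eq_iff outer_def matrix_vector_mult_def inner_vec_def sum_distrib_left mult_ac)

text \<open>Makes \<open>mat 1 + outer a (root_vec a)\<close> the symmetric positive definite square
  root of \<open>mat 1 + outer a a\<close>: the factor \<kappa> in front of \<open>a\<close> is the
  nonnegative solution of
  \<open>2 * \<kappa> + \<kappa> * \<kappa> * (a \<bullet> a) = 1\<close>.\<close>

definition root_vec :: "real^'n \<Rightarrow> real^'n" where
  "root_vec a = (1 / (1 + sqrt (1 + a \<bullet> a))) *\<^sub>R a"

text \<open>The square root in the denominator lies between \<open>norm a\<close> and
  \<open>1 + norm a\<close>. The upper bound makes the coefficient vectors compact even for
  diverging \<open>a\<close>; the lower one keeps their limits away from zero.\<close>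

lemma norm_root_vec: "norm (root_vec a) \<le> 1" "1 \<le> norm a \<Longrightarrow> 1/3 \<le> norm (root_vec a)"
proof -
  define w where "w = sqrt (1 + a \<bullet> a)"
  have n: "norm (root_vec a) = norm a / (1 + w)" and w0: "w \<ge> 0"
    by (simp_all add: root_vec_def w_def)
  have "norm a \<le> w" unfolding w_def norm_eq_sqrt_inner by (intro real_sqrt_le_mono) simp
  then show "norm (root_vec a) \<le> 1" unfolding n using w0 by simp
  assume 1: "1 \<le> norm a"
  have "w \<le> sqrt ((1 + norm a)\<^sup>2)"
    unfolding w_def by (intro real_sqrt_le_mono) (simp add: power2_eq_square algebra_simps power2_norm_eq_inner[symmetric])
  then have "w \<le> 1 + norm a" by simp
  then have "1 + w \<le> 3 * norm a" using 1 by linarith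
  then show "1/3 \<le> norm (root_vec a)" unfolding n using w0 by (simp add: field_simps)
qed

lemma rank_one_root:
  fixes a :: "real^'n"
  defines "L \<equiv> mat 1 + outer a (root_vec a)"
  shows "L *v z = z + (root_vec a \<bullet> z) *\<^sub>R a"
    and "(L ** transpose L) *v z = z + (a \<bullet> z) *\<^sub>R a"
    and "invertible L"
proof -
  show L: "L *v z = z + (root_vec a \<bullet> z) *\<^sub>R a" for z
    by (simp add: L_def matrix_vector_mult_add_rdistrib outer_mult)
  define w where "w = sqrt (1 + a \<bullet> a)"
  have w: "w\<^sup>2 = 1 + a \<bullet> a" "w \<ge> 0" by (simp_all add: w_def)
  define \<kappa> where "\<kappa> = 1 / (1 + w)"
  have r: "root_vec a = \<kappa> *\<^sub>R a" by (simp add: root_vec_def \<kappa>_def w_def)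
  have t: "transpose L = L"
    by (simp add: L_def r vec_eq_iff transpose_def outer_def mat_def)
  have "\<kappa> * (1 + w) = 1" using w by (simp add: \<kappa>_def)
  then have k: "2 * \<kappa> + \<kappa> * \<kappa> * (a \<bullet> a) = 1"
    using w(1) by (simp add: power2_eq_square) algebra
  have "(L ** transpose L) *v z = z + ((2 * \<kappa> + \<kappa> * \<kappa> * (a \<bullet> a)) * (a \<bullet> z)) *\<^sub>R a"
    unfolding t matrix_vector_mul_assoc[symmetric] L r
    by (simp add: inner_add_right add.assoc flip: scaleR_add_left) (simp add: algebra_simps)
  then show "(L ** transpose L) *v z = z + (a \<bullet> z) *\<^sub>R a" by (simp add: k)
  show "invertible L"
  proof (rule pos_def_imp_invertible)
    fix z :: "real^'n" assume "z \<noteq> 0"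
    have "z \<bullet> (L *v z) = z \<bullet> z + \<kappa> * (a \<bullet> z)\<^sup>2"
      by (simp add: L r inner_add_right power2_eq_square inner_commute)
    moreover have "\<kappa> * (a \<bullet> z)\<^sup>2 \<ge> 0" using w by (simp add: \<kappa>_def)
    ultimately show "z \<bullet> (L *v z) > 0" using \<open>z \<noteq> 0\<close> by (simp add: add_pos_nonneg)
  qed
qed

text \<open>Take a root \<open>L1\<close> for \<open>a\<close>, solve \<open>L1 *v d = b\<close>,
  and multiply by a root for \<open>d\<close>: conjugating \<open>mat 1 + outer d d\<close> with
  \<open>L1\<close> adds precisely \<open>outer b b\<close>. However large \<open>d\<close> is, its
  coefficient vector has norm at most one.\<close>

lemma rank_two_root:
  fixes a b :: "real^'n"
  shows "\<exists>L u w. invertible L \<and> L ** transpose L = mat 1 + outer a a + outer b b \<and>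
    (\<forall>z. L *v z = z + (u \<bullet> z) *\<^sub>R a + (w \<bullet> z) *\<^sub>R b) \<and>
    norm u \<le> 1 \<and> norm w \<le> 1 \<and> (1 \<le> norm a \<longrightarrow> 1/3 \<le> norm u)"
proof -
  define L1 where "L1 = mat 1 + outer a (root_vec a)"
  note L1 = rank_one_root[of a, folded L1_def]
  define d where "d = matrix_inv L1 *v b"
  have d: "L1 *v d = b" by (simp add: d_def matrix_vector_mul_assoc matrix_inv_inverse L1)
  define L2 where "L2 = mat 1 + outer d (root_vec d)"
  note L2 = rank_one_root[of d, folded L2_def]
  have "((L1 ** L2) ** transpose (L1 ** L2)) *v z = (mat 1 + outer a a + outer b b) *v z" for z
  proof -
    have "((L1 ** L2) ** transpose (L1 ** L2)) *v z = L1 *v ((L2 ** transpose L2) *v (transpose L1 *v z))"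
      by (simp add: matrix_vector_mul_assoc matrix_transpose_mul matrix_mul_assoc del: transpose_matrix_vector)
    also have "\<dots> = (L1 ** transpose L1) *v z + (d \<bullet> (transpose L1 *v z)) *\<^sub>R (L1 *v d)"
      by (simp only: L2 matrix_vector_right_distrib matrix_vector_mult_scaleR) (simp only: matrix_vector_mul_assoc)
    also have "\<dots> = (mat 1 + outer a a + outer b b) *v z"
      by (simp add: L1(2) d inner_transpose_mult matrix_vector_mult_add_rdistrib outer_mult del: transpose_matrix_vector)
    finally show ?thesis .
  qed
  then have "(L1 ** L2) ** transpose (L1 ** L2) = mat 1 + outer a a + outer b b"
    by (simp add: matrix_eq)
  moreover have "invertible (L1 ** L2)" using L1 L2 by (intro invertible_mult)
  moreover have "(L1 ** L2) *v z = z + (root_vec a \<bullet> z) *\<^sub>R a + (root_vec d \<bullet> z) *\<^sub>R b" for z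
    by (simp add: matrix_vector_mul_assoc[symmetric] L2 matrix_vector_right_distrib matrix_vector_mult_scaleR d)
       (simp add: L1)
  ultimately show ?thesis using norm_root_vec by blast
qed

section \<open>Diverging perturbations\<close>

context regression begin

lemma omega_hat_tendsto:
  assumes "((\<lambda>m. u_hat X (f m)) \<longlongrightarrow> u_hat X z) F"
  shows "((\<lambda>m. omega_hat X W (f m)) \<longlongrightarrow> omega_hat X W z) F"
  unfolding omega_hat_def
  by (intro tendsto_intros assms bounded_linear.tendsto[OF matrix_vector_mul_bounded_linear]) simp

text \<open>Along \<open>a\<close>, \<open>Rb\<close> escapes at the rate \<alpha> in the direction
  \<open>v\<close>; along \<open>b\<close> it stays below that rate; neither affects the residuals
  in the limit.\<close>

lemma divergent_perturbation_bound:
  fixes a b :: "nat \<Rightarrow> real^'n" and \<alpha> :: "nat \<Rightarrow> real" and v :: "real^'q"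
  assumes W: "\<exists>v. omega_hat X W v \<noteq> 0"
    and ua: "(\<lambda>m. u_hat X (a m)) \<longlonglongrightarrow> 0" and ub: "(\<lambda>m. u_hat X (b m)) \<longlonglongrightarrow> 0"
    and \<alpha>: "filterlim \<alpha> at_top sequentially"
    and Ra: "(\<lambda>m. (1 / \<alpha> m) *\<^sub>R Rb (a m)) \<longlonglongrightarrow> v" and v: "v \<noteq> 0"
    and Rb0: "(\<lambda>m. (1 / \<alpha> m) *\<^sub>R Rb (b m)) \<longlonglongrightarrow> 0"
    and le: "\<And>m. emeasure (gaussian 0 (mat 1 + outer (a m) (a m) + outer (b m) (b m)))
      {z. F_type_stat R 0 (beta_hat X) (Omega_W X R W) {} z \<ge> C} \<le> s"
  shows "emeasure (gaussian 0 (mat 1)) {y. omega_hat X W y \<ge> 0} \<le> s"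
proof -
  define T where "T = F_type_stat R 0 (beta_hat X) (Omega_W X R W) {}"
  have [measurable]: "T \<in> borel_measurable borel" by (simp add: T_def measurable_F_type_stat)
  \<comment> \<open>A triple packs the root and its two coefficient vectors, so that a single choice
    yields all three sequences.\<close>
  have "\<forall>m. \<exists>p. (invertible (fst p) \<and> fst p ** transpose (fst p) = mat 1 + outer (a m) (a m) + outer (b m) (b m) \<and>
    (\<forall>z. fst p *v z = z + (fst (snd p) \<bullet> z) *\<^sub>R a m + (snd (snd p) \<bullet> z) *\<^sub>R b m) \<and>
    norm (fst (snd p)) \<le> 1 \<and> norm (snd (snd p)) \<le> 1 \<and> (1 \<le> norm (a m) \<longrightarrow> 1/3 \<le> norm (fst (snd p))))"
    (is "\<forall>m. ?P m")
  proof
    fix m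
    obtain L u w where "invertible L \<and> L ** transpose L = mat 1 + outer (a m) (a m) + outer (b m) (b m) \<and>
      (\<forall>z. L *v z = z + (u \<bullet> z) *\<^sub>R a m + (w \<bullet> z) *\<^sub>R b m) \<and>
      norm u \<le> 1 \<and> norm w \<le> 1 \<and> (1 \<le> norm (a m) \<longrightarrow> 1/3 \<le> norm u)"
      using rank_two_root by blast
    then show "?P m" by (intro exI[of _ "(L, u, w)"]) simp
  qed
  from choice[OF this] obtain p where
    p: "\<And>m. invertible (fst (p m))"
    "\<And>m. fst (p m) ** transpose (fst (p m)) = mat 1 + outer (a m) (a m) + outer (b m) (b m)"
    "\<And>m z. fst (p m) *v z = z + (fst (snd (p m)) \<bullet> z) *\<^sub>R a m + (snd (snd (p m)) \<bullet> z) *\<^sub>R b m"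
    "\<And>m. norm (fst (snd (p m))) \<le> 1" "\<And>m. norm (snd (snd (p m))) \<le> 1"
    "\<And>m. 1 \<le> norm (a m) \<Longrightarrow> 1/3 \<le> norm (fst (snd (p m)))"
    by blast
  define L u w where "L m = fst (p m)" and "u m = fst (snd (p m))" and "w m = snd (snd (p m))" for m
  note L = p[folded L_def u_def w_def]
  \<comment> \<open>The coefficient vectors of \<open>a\<close> need not converge, but they lie in
    the unit ball; everything below runs along a subsequence \<pi> on which they tend to
    \<open>l\<close>.\<close>
  have "\<exists>l\<in>cball 0 1. \<exists>\<pi>. strict_mono \<pi> \<and> (u \<circ> \<pi>) \<longlonglongrightarrow> l"
    using L(4) compact_cball[of "0::real^'n" 1] unfolding compact_def by simp
  then obtain l \<pi> where \<pi>: "strict_mono \<pi>" and l: "(\<lambda>m. u (\<pi> m)) \<longlonglongrightarrow> l"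
    by (auto simp: o_def)
  have sub: "(\<lambda>m. f (\<pi> m)) \<longlonglongrightarrow> x" if "f \<longlonglongrightarrow> x" for f :: "nat \<Rightarrow> 'z::topological_space" and x
    using LIMSEQ_subseq_LIMSEQ[OF that \<pi>] by (simp add: o_def)
  have \<alpha>\<pi>: "filterlim (\<lambda>m. \<alpha> (\<pi> m)) at_top sequentially"
    using \<alpha> filterlim_subseq[OF \<pi>] by (rule filterlim_compose)
  \<comment> \<open>Since \<open>Rb (a m)\<close> grows like \<alpha>, its norm eventually exceeds
    the operator bound \<open>K\<close>. The lower bound 1/3 then applies and gives
    \<open>l \<noteq> 0\<close>.\<close>
  have "eventually (\<lambda>m. 1 \<le> norm (a m)) sequentially"
  proof -
    obtain K where K: "K > 0" "\<And>x. norm (Rb x) \<le> norm x * K"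
      using bounded_linear.pos_bounded linear_Rb by (auto simp: linear_conv_bounded_linear)
    have "filterlim (\<lambda>m. norm ((1 / \<alpha> m) *\<^sub>R Rb (a m)) * \<alpha> m) at_top sequentially"
      using v by (intro filterlim_tendsto_pos_mult_at_top[OF tendsto_norm[OF Ra] _ \<alpha>]) simp
    then have "eventually (\<lambda>m. K \<le> norm ((1 / \<alpha> m) *\<^sub>R Rb (a m)) * \<alpha> m) sequentially"
      by (simp add: filterlim_at_top)
    moreover have "eventually (\<lambda>m. \<alpha> m > 0) sequentially"
      using \<alpha> by (simp add: filterlim_at_top_dense)
    ultimately show ?thesis
    proof eventually_elim
      case (elim m)
      then have "K \<le> norm (Rb (a m))" by simp
      also have "\<dots> \<le> norm (a m) * K" by (rule K)
      finally show ?case using K(1) by simp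
    qed
  qed
  then have "eventually (\<lambda>m. 1/3 \<le> norm (u m)) sequentially"
    by (rule eventually_mono) (rule L(6))
  then have "eventually (\<lambda>m. 1/3 \<le> norm (u (\<pi> m))) sequentially"
    by (rule eventually_subseq[OF \<pi>])
  then have "1/3 \<le> norm l"
    by (rule tendsto_lowerbound[OF tendsto_norm[OF l]]) simp
  then have l0: "l \<noteq> 0" by auto
  have "{z. l \<bullet> z = 0} \<in> null_sets lborel"
  proof (rule null_set_if_finite_lines)
    have "l \<bullet> l \<noteq> 0" using l0 by simp
    from finite_line_solutions[OF this]
    show "finite {\<tau>. x + \<tau> *\<^sub>R l \<in> {z. l \<bullet> z = 0}}" for x
      by (simp add: inner_add_right)
  qed measurable
  from AE_not_in[OF this] have AEl: "AE z in lborel. l \<bullet> z \<noteq> 0" by simp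
  \<comment> \<open>Along the transformed points the variance estimator tends to its positive value
    at \<open>z\<close>, while \<open>Rb\<close> divided by \<alpha> tends to the nonzero vector
    \<open>(l \<bullet> z) *\<^sub>R v\<close>. The statistic hence grows like the square of
    \<alpha> and exceeds any \<open>C\<close>.\<close>
  have ev: "eventually (\<lambda>m. C \<le> T (L (\<pi> m) *v z)) sequentially"
    if z: "omega_hat X W z > 0" "l \<bullet> z \<noteq> 0" for z
  proof -
    define Z where "Z m = L (\<pi> m) *v z" for m
    have bounded_mult: "(\<lambda>m. (y m \<bullet> z) *\<^sub>R x m) \<longlonglongrightarrow> 0"
      if "x \<longlonglongrightarrow> 0" "\<And>m. norm (y m) \<le> 1" for x :: "nat \<Rightarrow> 'z::real_normed_vector" and y :: "nat \<Rightarrow> real^'n"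
    proof (rule Lim_null_comparison[OF always_eventually])
      show "\<forall>m. norm ((y m \<bullet> z) *\<^sub>R x m) \<le> norm z * norm (x m)"
      proof
        fix m
        have "\<bar>y m \<bullet> z\<bar> \<le> norm (y m) * norm z" by (rule Cauchy_Schwarz_ineq2)
        also have "\<dots> \<le> norm z" using that(2)[of m] by (simp add: mult_left_le_one_le)
        finally show "norm ((y m \<bullet> z) *\<^sub>R x m) \<le> norm z * norm (x m)"
          by (simp add: mult_right_mono)
      qed
      show "(\<lambda>m. norm z * norm (x m)) \<longlonglongrightarrow> 0"
        using that(1) by (intro tendsto_mult_right_zero tendsto_norm_zero)
    qed
    have "(\<lambda>m. u_hat X z + (u (\<pi> m) \<bullet> z) *\<^sub>R u_hat X (a (\<pi> m)) + (w (\<pi> m) \<bullet> z) *\<^sub>R u_hat X (b (\<pi> m)))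
        \<longlonglongrightarrow> u_hat X z + 0 + 0"
      by (intro tendsto_intros bounded_mult sub[OF ua] sub[OF ub] L)
    then have "(\<lambda>m. u_hat X (Z m)) \<longlonglongrightarrow> u_hat X z"
      by (simp add: Z_def L linear_add[OF linear_u_hat] linear_scale[OF linear_u_hat])
    then have om: "(\<lambda>m. omega_hat X W (Z m)) \<longlonglongrightarrow> omega_hat X W z" by (rule omega_hat_tendsto)
    define x where "x m = (1 / \<alpha> (\<pi> m)) *\<^sub>R Rb (Z m)" for m
    have "(\<lambda>m. (1 / \<alpha> (\<pi> m)) *\<^sub>R Rb z + (u (\<pi> m) \<bullet> z) *\<^sub>R ((1 / \<alpha> (\<pi> m)) *\<^sub>R Rb (a (\<pi> m)))
        + (w (\<pi> m) \<bullet> z) *\<^sub>R ((1 / \<alpha> (\<pi> m)) *\<^sub>R Rb (b (\<pi> m)))) \<longlonglongrightarrow> 0 *\<^sub>R Rb z + (l \<bullet> z) *\<^sub>R v + 0"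
      by (intro tendsto_intros bounded_mult l sub[OF Ra] sub[OF Rb0] L
          tendsto_divide_0[OF tendsto_const filterlim_at_top_imp_at_infinity[OF \<alpha>\<pi>]])
    then have x: "x \<longlonglongrightarrow> (l \<bullet> z) *\<^sub>R v"
      by (simp add: x_def[abs_def] Z_def L linear_add[OF linear_Rb] linear_scale[OF linear_Rb] scaleR_add_right mult.commute)
    define Q where "Q y = y \<bullet> (matrix_inv M *v y)" for y
    have lim: "(\<lambda>m. Q (x m) / omega_hat X W (Z m)) \<longlonglongrightarrow> Q ((l \<bullet> z) *\<^sub>R v) / omega_hat X W z"
      unfolding Q_def using z
      by (intro tendsto_intros x om bounded_linear.tendsto[OF matrix_vector_mul_bounded_linear]) simp
    have "Q ((l \<bullet> z) *\<^sub>R v) > 0"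
      unfolding Q_def using z v by (intro pos_def_matrix_inv M_pos_def) auto
    then have "filterlim (\<lambda>m. Q (x m) / omega_hat X W (Z m) * (\<alpha> (\<pi> m) * \<alpha> (\<pi> m))) at_top sequentially"
      using z by (intro filterlim_tendsto_pos_mult_at_top[OF lim _ filterlim_at_top_mult_at_top[OF \<alpha>\<pi> \<alpha>\<pi>]]) simp
    then have "eventually (\<lambda>m. C \<le> Q (x m) / omega_hat X W (Z m) * (\<alpha> (\<pi> m) * \<alpha> (\<pi> m))) sequentially"
      by (simp add: filterlim_at_top)
    moreover have "eventually (\<lambda>m. \<alpha> (\<pi> m) > 0) sequentially"
      using \<alpha>\<pi> by (simp add: filterlim_at_top_dense)
    moreover have "eventually (\<lambda>m. omega_hat X W (Z m) > 0) sequentially"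
      using om z by (simp add: order_tendstoD)
    ultimately show ?thesis
    proof eventually_elim
      case (elim m)
      have "Rb (Z m) = \<alpha> (\<pi> m) *\<^sub>R x m" using elim by (simp add: x_def)
      then have "T (Z m) = Q (x m) / omega_hat X W (Z m) * (\<alpha> (\<pi> m) * \<alpha> (\<pi> m))"
        using elim by (simp add: T_def F_type_stat_eq Q_def matrix_vector_mult_scaleR)
      then show ?case using elim by (simp add: Z_def)
    qed
  qed
  let ?G = "gaussian 0 (mat 1 :: real^'n^'n)"
  \<comment> \<open>Almost everywhere a nonnegative variance estimate is positive, so the rejection
    event eventually occurs at \<open>z\<close>. Fatou's lemma integrates this inequality.\<close>
  have "AE z in lborel. indicator {y. omega_hat X W y \<ge> 0} z
      \<le> liminf (\<lambda>m. indicator {z. C \<le> T (L (\<pi> m) *v z)} z :: ennreal)"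
    using AE_omega_hat_nonzero[OF W] AEl
  proof eventually_elim
    case (elim z)
    show ?case
    proof (cases "omega_hat X W z > 0")
      case True
      have "eventually (\<lambda>m. 1 \<le> (indicator {z. C \<le> T (L (\<pi> m) *v z)} z :: ennreal)) sequentially"
        using ev[OF True] elim by (auto elim: eventually_mono)
      then have "1 \<le> liminf (\<lambda>m. indicator {z. C \<le> T (L (\<pi> m) *v z)} z :: ennreal)"
        by (rule Liminf_bounded)
      then show ?thesis by (simp add: indicator_def)
    qed (use elim in \<open>simp add: indicator_def\<close>)
  qed
  then have "AE z in ?G. indicator {y. omega_hat X W y \<ge> 0} z
      \<le> liminf (\<lambda>m. indicator {z. C \<le> T (L (\<pi> m) *v z)} z :: ennreal)"
    by (rule AE_gaussian)
  then have "(\<integral>\<^sup>+z. indicator {y. omega_hat X W y \<ge> 0} z \<partial>?G)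
      \<le> (\<integral>\<^sup>+z. liminf (\<lambda>m. indicator {z. C \<le> T (L (\<pi> m) *v z)} z) \<partial>?G)"
    by (rule nn_integral_mono_AE)
  also have "\<dots> \<le> liminf (\<lambda>m. \<integral>\<^sup>+z. indicator {z. C \<le> T (L (\<pi> m) *v z)} z \<partial>?G)"
    by (rule nn_integral_liminf) measurable
  also have "\<dots> \<le> s"
  proof (intro Liminf_le always_eventually allI)
    fix m
    \<comment> \<open>The linear map turns the standard normal law into the one with covariance
      \<open>L ** transpose L\<close>, for which the bound is assumed.\<close>
    have "(\<integral>\<^sup>+z. indicator {z. C \<le> T (L (\<pi> m) *v z)} z \<partial>?G) = emeasure ?G {z. 0 + L (\<pi> m) *v z \<in> {y. C \<le> T y}}"
      by (subst nn_integral_indicator) auto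
    also have "\<dots> = emeasure (gaussian 0 (L (\<pi> m) ** mat 1 ** transpose (L (\<pi> m)))) {y. C \<le> T y}"
      by (rule emeasure_gaussian_linear[OF L(1), symmetric]) (simp_all add: invertible_right_inverse)
    also have "\<dots> \<le> s" using le[of "\<pi> m"] by (simp add: L T_def)
    finally show "(\<integral>\<^sup>+z. indicator {z. C \<le> T (L (\<pi> m) *v z)} z \<partial>?G) \<le> s" .
  qed simp
  finally show ?thesis by simp
qed

end

section \<open>Polynomial trends\<close>

lemma cos_taylor_bound: "\<bar>cos x - (\<Sum>i<K. cos_coeff i * x ^ i)\<bar> \<le> \<bar>x\<bar> ^ K"
proof -
  obtain y where "cos x = (\<Sum>i<K. cos_coeff i * x ^ i) + cos (y + 1/2 * real K * pi) / fact K * x ^ K"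
    using Maclaurin_cos_expansion by blast
  then have "\<bar>cos x - (\<Sum>i<K. cos_coeff i * x ^ i)\<bar> = \<bar>cos (y + 1/2 * real K * pi)\<bar> / fact K * \<bar>x\<bar> ^ K"
    by (simp add: abs_mult power_abs)
  also have "\<bar>cos (y + 1/2 * real K * pi)\<bar> / fact K \<le> 1 / 1"
    by (intro frac_le) (auto simp: fact_ge_1)
  finally show ?thesis by (simp add: mult_right_mono)
qed

lemma sin_taylor_bound: "\<bar>sin x - (\<Sum>i<K. sin_coeff i * x ^ i)\<bar> \<le> \<bar>x\<bar> ^ K"
proof -
  obtain y where "sin x = (\<Sum>i<K. sin_coeff i * x ^ i) + sin (y + 1/2 * real K * pi) / fact K * x ^ K"
    using Maclaurin_sin_expansion by blast
  then have "\<bar>sin x - (\<Sum>i<K. sin_coeff i * x ^ i)\<bar> = \<bar>sin (y + 1/2 * real K * pi)\<bar> / fact K * \<bar>x\<bar> ^ K"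
    by (simp add: abs_mult power_abs)
  also have "\<bar>sin (y + 1/2 * real K * pi)\<bar> / fact K \<le> 1 / 1"
    by (intro frac_le) (auto simp: fact_ge_1)
  finally show ?thesis by (simp add: mult_right_mono)
qed

context regression begin

text \<open>The powers are chosen such that \<open>A \<gamma>\<^sup>K \<rightarrow> 0\<close> but \<open>A \<gamma>\<^sup>p \<rightarrow> \<infinity>\<close> for all \<open>p < K\<close>.\<close>

lemma trend_limits:
  fixes h :: "real \<Rightarrow> real" and g :: "nat \<Rightarrow> real" and \<tau> :: "'n \<Rightarrow> real" and b :: "nat \<Rightarrow> real^'k"
  assumes taylor: "\<And>x. \<bar>h x - (\<Sum>i<K. g i * x ^ i)\<bar> \<le> \<bar>x\<bar> ^ K"
    and b: "\<And>i. i < K \<Longrightarrow> X *v b i = (\<chi> l. \<tau> l ^ i)"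
    and p: "p < K" and Rp: "\<And>i. i < p \<Longrightarrow> R *v b i = 0"
  defines "\<gamma> \<equiv> \<lambda>m. 1 / (real (Suc m))\<^sup>2" and "A \<equiv> \<lambda>m. real (Suc m) ^ (2 * K - 1)"
  defines "a \<equiv> \<lambda>m. A m *\<^sub>R (\<chi> l. h (\<tau> l * \<gamma> m))"
  shows "(\<lambda>m. u_hat X (a m)) \<longlonglongrightarrow> 0"
    and "(\<lambda>m. (1 / (A m * \<gamma> m ^ p)) *\<^sub>R Rb (a m)) \<longlonglongrightarrow> g p *\<^sub>R (R *v b p)"
proof -
  \<comment> \<open>The trend vectors \<open>P i\<close> have no residuals; \<open>E\<close> is the
    Taylor remainder, of order \<open>\<gamma> ^ K\<close>, and is all that \<open>u_hat\<close>
    sees.\<close>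
  define P :: "nat \<Rightarrow> real^'n" where "P i = (\<chi> l. \<tau> l ^ i)" for i
  define E :: "nat \<Rightarrow> real^'n" where
    "E m = (\<chi> l. h (\<tau> l * \<gamma> m)) - (\<Sum>i<K. (g i * \<gamma> m ^ i) *\<^sub>R P i)" for m
  define K0 where "K0 = (\<Sum>l\<in>UNIV. \<bar>\<tau> l\<bar> ^ K)"
  have K0: "K0 \<ge> 0" by (simp add: K0_def sum_nonneg)
  have \<gamma>0: "\<gamma> m > 0" for m by (simp add: \<gamma>_def)
  have A0: "A m > 0" for m by (simp add: A_def)
  have a: "a m = A m *\<^sub>R (\<Sum>i<K. (g i * \<gamma> m ^ i) *\<^sub>R P i) + A m *\<^sub>R E m" for m
    by (simp add: a_def E_def scaleR_diff_right)
  have E: "norm (E m) \<le> K0 * \<gamma> m ^ K" for m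
  proof -
    have "norm (E m) \<le> (\<Sum>l\<in>UNIV. \<bar>E m $ l\<bar>)" by (rule norm_le_l1_cart)
    also have "\<dots> \<le> (\<Sum>l\<in>UNIV. \<bar>\<tau> l\<bar> ^ K * \<gamma> m ^ K)"
    proof (rule sum_mono)
      fix l
      have "E m $ l = h (\<tau> l * \<gamma> m) - (\<Sum>i<K. g i * (\<tau> l * \<gamma> m) ^ i)"
        by (simp add: E_def P_def power_mult_distrib mult_ac)
      then show "\<bar>E m $ l\<bar> \<le> \<bar>\<tau> l\<bar> ^ K * \<gamma> m ^ K"
        using taylor[of "\<tau> l * \<gamma> m"] \<gamma>0[of m] by (simp add: abs_mult power_mult_distrib)
    qed
    finally show ?thesis by (simp add: K0_def sum_distrib_right)
  qed
  have \<gamma>lim: "\<gamma> \<longlonglongrightarrow> 0"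
  proof -
    have "(\<lambda>m. (1 / real (Suc m))\<^sup>2) \<longlonglongrightarrow> 0\<^sup>2"
      by (intro tendsto_intros LIMSEQ_Suc lim_1_over_n)
    then show ?thesis by (simp add: \<gamma>_def power_divide)
  qed
  have uP: "u_hat X (P i) = 0" and RP: "Rb (P i) = R *v b i" if "i < K" for i
    using b[OF that, folded P_def] u_hat_X[of "b i"] beta_hat_X[of "b i"] by (simp_all add: Rb_def)
  obtain B where B: "B > 0" "\<And>x. norm (u_hat X x) \<le> norm x * B"
    using bounded_linear.pos_bounded linear_u_hat by (auto simp: linear_conv_bounded_linear)
  obtain B' where B': "B' > 0" "\<And>x. norm (Rb x) \<le> norm x * B'"
    using bounded_linear.pos_bounded linear_Rb by (auto simp: linear_conv_bounded_linear)
  have bound: "norm (u_hat X (a m)) \<le> K0 * B * (1 / real (Suc m))" for m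
  proof -
    have "u_hat X (a m) = A m *\<^sub>R u_hat X (E m)"
      by (simp add: a linear_add[OF linear_u_hat] linear_scale[OF linear_u_hat] linear_sum[OF linear_u_hat] uP)
    then have "norm (u_hat X (a m)) \<le> A m * (norm (E m) * B)"
      using A0[of m] B(2)[of "E m"] by (simp add: mult_left_mono)
    also have "\<dots> \<le> A m * (K0 * \<gamma> m ^ K * B)"
      using A0[of m] B(1) E[of m] by (intro mult_left_mono mult_right_mono) auto
    finally have "norm (u_hat X (a m)) \<le> (A m * \<gamma> m ^ K) * (K0 * B)" by (simp add: mult_ac)
    also have "A m * \<gamma> m ^ K = 1 / real (Suc m)"
    proof -
      define S where "S = real (Suc m)"
      have "S > 0" by (simp add: S_def)
      \<comment> \<open>As \<open>p < K\<close>, \<open>K\<close> is positive and the truncated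
        subtraction in the exponent is exact.\<close>
      have "2 * K = Suc (2 * K - 1)" using p by simp
      then have "S ^ (2 * K) = S * S ^ (2 * K - 1)" by (metis power_Suc)
      moreover have "A m * \<gamma> m ^ K = S ^ (2 * K - 1) / S ^ (2 * K)"
        by (simp only: A_def \<gamma>_def S_def power_divide power_mult power_one times_divide_eq_right mult_1_right)
      ultimately show ?thesis using \<open>S > 0\<close> unfolding S_def[symmetric] by simp
    qed
    finally show ?thesis by (simp only: mult_ac)
  qed
  have "(\<lambda>m. K0 * B * (1 / real (Suc m))) \<longlonglongrightarrow> K0 * B * 0"
    by (intro tendsto_intros LIMSEQ_Suc lim_1_over_n)
  then have "(\<lambda>m. K0 * B * (1 / real (Suc m))) \<longlonglongrightarrow> 0" by (simp only: mult_zero_right)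
  then show "(\<lambda>m. u_hat X (a m)) \<longlonglongrightarrow> 0"
    by (rule Lim_null_comparison[OF always_eventually[OF allI[OF bound]]])
  have decomp: "(1 / (A m * \<gamma> m ^ p)) *\<^sub>R Rb (a m)
      = (\<Sum>i<K. (g i * (\<gamma> m ^ i / \<gamma> m ^ p)) *\<^sub>R (R *v b i)) + (1 / \<gamma> m ^ p) *\<^sub>R Rb (E m)" for m
  proof -
    have k: "1 / (A m * \<gamma> m ^ p) * A m = 1 / \<gamma> m ^ p" using A0[of m] by simp
    have "Rb (\<Sum>i<K. (g i * \<gamma> m ^ i) *\<^sub>R P i) = (\<Sum>i<K. (g i * \<gamma> m ^ i) *\<^sub>R (R *v b i))"
      unfolding linear_sum[OF linear_Rb] by (rule sum.cong) (simp_all add: linear_scale[OF linear_Rb] RP)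
    then have "(1 / (A m * \<gamma> m ^ p)) *\<^sub>R Rb (a m)
        = (1 / \<gamma> m ^ p) *\<^sub>R (\<Sum>i<K. (g i * \<gamma> m ^ i) *\<^sub>R (R *v b i)) + (1 / \<gamma> m ^ p) *\<^sub>R Rb (E m)"
      by (simp only: a linear_add[OF linear_Rb] linear_scale[OF linear_Rb] scaleR_add_right scaleR_scaleR k)
    then show ?thesis by (simp add: scaleR_sum_right)
  qed
  have "(\<lambda>m. (\<Sum>i<K. (g i * (\<gamma> m ^ i / \<gamma> m ^ p)) *\<^sub>R (R *v b i)))
      \<longlonglongrightarrow> (\<Sum>i<K. if i = p then g p *\<^sub>R (R *v b p) else 0)"
  proof (rule tendsto_sum)
    fix i
    \<comment> \<open>Terms below \<open>p\<close> are annihilated by \<open>R\<close>, those above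
      carry a positive power of \<gamma>; only the term at \<open>p\<close> survives.\<close>
    consider "i < p" | "i = p" | "p < i" by linarith
    then show "(\<lambda>m. (g i * (\<gamma> m ^ i / \<gamma> m ^ p)) *\<^sub>R (R *v b i)) \<longlonglongrightarrow> (if i = p then g p *\<^sub>R (R *v b p) else 0)"
    proof cases
      case 1
      then show ?thesis by (simp add: Rp)
    next
      case 2
      have "\<gamma> m ^ p / \<gamma> m ^ p = 1" for m using \<gamma>0[of m] by simp
      then show ?thesis using 2 by simp
    next
      case 3
      have "\<gamma> m ^ i / \<gamma> m ^ p = \<gamma> m ^ (i - p)" for m
        using 3 \<gamma>0[of m] by (simp add: power_diff)
      moreover have "(\<lambda>m. (g i * \<gamma> m ^ (i - p)) *\<^sub>R (R *v b i)) \<longlonglongrightarrow> (g i * 0 ^ (i - p)) *\<^sub>R (R *v b i)"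
        by (intro tendsto_intros \<gamma>lim)
      ultimately show ?thesis using 3 by (simp add: power_0_left)
    qed
  qed
  moreover have "(\<lambda>m. (1 / \<gamma> m ^ p) *\<^sub>R Rb (E m)) \<longlonglongrightarrow> 0"
  proof (rule Lim_null_comparison[OF always_eventually])
    show "\<forall>m. norm ((1 / \<gamma> m ^ p) *\<^sub>R Rb (E m)) \<le> K0 * B' * \<gamma> m ^ (K - p)"
    proof
      fix m
      have "norm ((1 / \<gamma> m ^ p) *\<^sub>R Rb (E m)) \<le> (1 / \<gamma> m ^ p) * (norm (E m) * B')"
        using \<gamma>0[of m] B'(2)[of "E m"] by (simp add: divide_right_mono)
      also have "\<dots> \<le> (1 / \<gamma> m ^ p) * (K0 * \<gamma> m ^ K * B')"
        using \<gamma>0[of m] B'(1) E[of m] by (intro mult_left_mono mult_right_mono) auto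
      also have "\<dots> = K0 * B' * \<gamma> m ^ (K - p)"
        using p \<gamma>0[of m] by (simp add: power_diff)
      finally show "norm ((1 / \<gamma> m ^ p) *\<^sub>R Rb (E m)) \<le> K0 * B' * \<gamma> m ^ (K - p)" .
    qed
    have "(\<lambda>m. K0 * B' * \<gamma> m ^ (K - p)) \<longlonglongrightarrow> K0 * B' * 0 ^ (K - p)"
      by (intro tendsto_intros \<gamma>lim)
    then show "(\<lambda>m. K0 * B' * \<gamma> m ^ (K - p)) \<longlonglongrightarrow> 0" using p by (simp add: power_0_left)
  qed
  ultimately have "(\<lambda>m. (\<Sum>i<K. (g i * (\<gamma> m ^ i / \<gamma> m ^ p)) *\<^sub>R (R *v b i)) + (1 / \<gamma> m ^ p) *\<^sub>R Rb (E m))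
      \<longlonglongrightarrow> (\<Sum>i<K. if i = p then g p *\<^sub>R (R *v b p) else 0) + 0"
    by (rule tendsto_add)
  then show "(\<lambda>m. (1 / (A m * \<gamma> m ^ p)) *\<^sub>R Rb (a m)) \<longlonglongrightarrow> g p *\<^sub>R (R *v b p)"
    unfolding decomp using p by simp
qed

text \<open>\<open>V\<close> is the limit of \<open>Vm\<close>, each of which is a positive multiple
  of the covariance matrix of a mixture in \<open>FF\<close>. Invariance of the statistic removes
  the multiple, and lower semicontinuity passes to the limit.\<close>

lemma cosine_covariance_bound:
  fixes t :: "'n \<Rightarrow> nat"
  assumes t: "inj t" and FF: "F_AR2_ext \<subseteq> FF" "FF \<subseteq> F_all"
    and \<mu>: "\<mu> \<in> M0 X R r" and \<sigma>: "\<sigma>2 > 0" and \<gamma>: "0 < \<gamma>" "\<gamma> < pi"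
    and V: "\<And>j l. V $ j $ l = A\<^sup>2 * cos ((real (t j) - real (t l)) * \<gamma>) + mat 1 $ j $ l"
  shows "emeasure (gaussian 0 V) {z. F_type_stat R 0 (beta_hat X) (Omega_W X R W) {} z \<ge> C}
    \<le> (SUP f\<in>FF. emeasure (gaussian \<mu> (\<sigma>2 *\<^sub>R Sigma_spec t f))
          {y. F_type_stat R r (beta_hat X) (Omega_W X R W) {} y \<ge> C})" (is "_ \<le> ?s")
proof -
  obtain f where f: "\<And>m. f m \<in> F_AR2"
    and lim: "\<And>j l. (\<lambda>m. Sigma_spec t (f m) $ j $ l) \<longlonglongrightarrow> cos ((real (t j) - real (t l)) * \<gamma>)"
    using Sigma_spec_AR2_limit[OF \<gamma>] by metis
  define Vm where "Vm m = A\<^sup>2 *\<^sub>R Sigma_spec t (f m) + mat 1" for m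
  have F: "f m \<in> F_all" for m using f[of m] by (simp add: F_AR2_def)
  show ?thesis
  proof (rule emeasure_gaussian_lower_semicontinuous)
    show "(\<lambda>m. Vm m $ j $ l) \<longlonglongrightarrow> V $ j $ l" for j l
      unfolding Vm_def V by (auto intro!: tendsto_intros lim)
    show pos: "z \<bullet> z \<le> z \<bullet> (Vm m *v z)" for m z
    proof -
      have "z \<bullet> (Sigma_spec t (f m) *v z) \<ge> 0"
        using Sigma_spec_pos_def[OF F t, of z m] by (cases "z = 0") auto
      then show ?thesis
        by (simp add: Vm_def matrix_vector_mult_add_rdistrib inner_add_right flip: scaleR_matrix_vector_assoc)
    qed
    show "{z. F_type_stat R 0 (beta_hat X) (Omega_W X R W) {} z \<ge> C} \<in> sets borel"
      by measurable
    fix m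
    \<comment> \<open>The weights \<open>A\<^sup>2 * c\<close> and \<open>c\<close> sum to one; the
      factor \<open>\<sigma>2 * c\<close> then relating the two covariance matrices is absorbed by
      the scale \<open>s\<close>.\<close>
    define c where "c = 1 / (1 + A\<^sup>2)"
    define g where "g = (\<lambda>\<omega>\<in>{-pi..pi}. (A\<^sup>2 * c) * f m \<omega> + c / (2 * pi))"
    define s where "s = sqrt (\<sigma>2 * c)"
    have c: "c > 0" "A\<^sup>2 * c + c = 1"
      by (auto simp: c_def add_pos_nonneg field_simps add_nonneg_eq_0_iff)
    have s: "s > 0" "s\<^sup>2 = \<sigma>2 * c" using \<sigma> c by (auto simp: s_def)
    have "g \<in> F_AR2_ext" unfolding F_AR2_ext_def mem_Collect_eq
      by (intro exI[of _ "f m"] exI[of _ "A\<^sup>2 * c"] exI[of _ c]) (use f c in \<open>auto simp: g_def\<close>)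
    then have gF: "g \<in> FF" "g \<in> F_all" using FF by auto
    have S: "\<sigma>2 *\<^sub>R Sigma_spec t g = s\<^sup>2 *\<^sub>R Vm m"
      by (simp add: Sigma_spec_mixture[OF F gF(2) t g_def] s Vm_def scaleR_add_right mult_ac)
    have "invertible (Vm m)"
      by (rule pos_def_imp_invertible) (use pos order_less_le_trans inner_gt_zero_iff in blast)
    then have "emeasure (gaussian \<mu> (\<sigma>2 *\<^sub>R Sigma_spec t g)) {y. F_type_stat R r (beta_hat X) (Omega_W X R W) {} y \<ge> C}
        = emeasure (gaussian 0 (Vm m)) {z. F_type_stat R 0 (beta_hat X) (Omega_W X R W) {} z \<ge> C}"
      unfolding S by (subst emeasure_gaussian_scale[OF s(1)]) (simp_all add: F_type_stat_invariant[OF s(1) \<mu>])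
    then show "emeasure (gaussian 0 (Vm m)) {z. F_type_stat R 0 (beta_hat X) (Omega_W X R W) {} z \<ge> C} \<le> ?s"
      using gF(1) by (metis (mono_tags, lifting) SUP_upper)
  qed
qed

lemma null_bound:
  fixes t :: "'n \<Rightarrow> nat" and b :: "nat \<Rightarrow> real^'k"
  assumes W: "\<exists>v. omega_hat X W v \<noteq> 0" and t: "inj t" and FF: "F_AR2_ext \<subseteq> FF" "FF \<subseteq> F_all"
    and \<mu>: "\<mu> \<in> M0 X R r" and \<sigma>: "\<sigma>2 > 0"
    and b: "\<And>i. i < K \<Longrightarrow> X *v b i = (\<chi> l. real (t l) ^ i)"
    and nz: "\<exists>i<K. R *v b i \<noteq> 0"
  shows "emeasure (gaussian 0 (mat 1)) {y. omega_hat X W y \<ge> 0}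
    \<le> (SUP f\<in>FF. emeasure (gaussian \<mu> (\<sigma>2 *\<^sub>R Sigma_spec t f))
          {y. F_type_stat R r (beta_hat X) (Omega_W X R W) {} y \<ge> C})"
proof -
  \<comment> \<open>The lowest trend degree visible to \<open>R\<close>; all lower Taylor terms
    disappear from \<open>Rb\<close>, so it determines the rate \<alpha>.\<close>
  define p where "p = (LEAST i. R *v b i \<noteq> 0)"
  obtain i0 where i0: "i0 < K" "R *v b i0 \<noteq> 0" using nz by blast
  have Rp: "R *v b p \<noteq> 0" unfolding p_def by (rule LeastI) (rule i0)
  have p: "p < K" using Least_le[of "\<lambda>i. R *v b i \<noteq> 0", OF i0(2)] i0(1) by (simp add: p_def)
  have Rp0: "R *v b i = 0" if "i < p" for i
    using not_less_Least[OF that[unfolded p_def]] by simp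
  define \<gamma> where "\<gamma> m = 1 / (real (Suc m))\<^sup>2" for m
  define A where "A m = real (Suc m) ^ (2 * K - 1)" for m
  define \<alpha> where "\<alpha> m = A m * \<gamma> m ^ p" for m
  define ac where "ac m = A m *\<^sub>R (\<chi> l. cos (real (t l) * \<gamma> m))" for m
  define as where "as m = A m *\<^sub>R (\<chi> l. sin (real (t l) * \<gamma> m))" for m
  note limc = trend_limits[where \<tau> = "\<lambda>l. real (t l)", OF cos_taylor_bound b p Rp0, folded A_def \<gamma>_def, folded ac_def \<alpha>_def]
  note lims = trend_limits[where \<tau> = "\<lambda>l. real (t l)", OF sin_taylor_bound b p Rp0, folded A_def \<gamma>_def, folded as_def \<alpha>_def]
  have \<alpha>: "filterlim \<alpha> at_top sequentially"
  proof (rule filterlim_at_top_mono[OF filterlim_real_sequentially], intro always_eventually allI)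
    fix m
    have "real (Suc m) ^ (2 * K - 1) = real (Suc m) ^ (2 * K - 1 - 2 * p) * real (Suc m) ^ (2 * p)"
      using p by (simp flip: power_add)
    then have "\<alpha> m = real (Suc m) ^ (2 * K - 1 - 2 * p)"
      by (simp add: \<alpha>_def A_def \<gamma>_def power_divide power_mult[symmetric] del: of_nat_Suc)
    \<comment> \<open>From \<open>p < K\<close> the exponent is at least one, so \<alpha> grows at
      least linearly.\<close>
    moreover have "real (Suc m) ^ 1 \<le> real (Suc m) ^ (2 * K - 1 - 2 * p)"
      using p by (intro power_increasing) auto
    ultimately show "real m \<le> \<alpha> m" by simp
  qed
  have le: "emeasure (gaussian 0 (mat 1 + outer (ac m) (ac m) + outer (as m) (as m)))
      {z. F_type_stat R 0 (beta_hat X) (Omega_W X R W) {} z \<ge> C}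
    \<le> (SUP f\<in>FF. emeasure (gaussian \<mu> (\<sigma>2 *\<^sub>R Sigma_spec t f))
          {y. F_type_stat R r (beta_hat X) (Omega_W X R W) {} y \<ge> C})" for m
  proof (rule cosine_covariance_bound[OF t FF \<mu> \<sigma>, where \<gamma> = "\<gamma> m" and A = "A m"])
    have "\<gamma> m \<le> 1" by (simp add: \<gamma>_def divide_le_eq)
    then show "\<gamma> m < pi" using pi_gt3 by linarith
    show "0 < \<gamma> m" by (simp add: \<gamma>_def)
  \<comment> \<open>The addition theorem splits \<open>cos\<close> of the lag into the cosine and
    sine products forming the two outer products.\<close>
  qed (simp add: outer_def ac_def as_def cos_diff left_diff_distrib power2_eq_square algebra_simps)
  show ?thesis
  \<comment> \<open>Cosine has only even and sine only odd Taylor coefficients. The parity of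
    \<open>p\<close> decides which of the two vectors makes \<open>Rb\<close> diverge; for the other
    one the limit at rate \<alpha> is zero.\<close>
  proof (cases "even p")
    case True
    show ?thesis
      by (rule divergent_perturbation_bound[OF W limc(1) lims(1) \<alpha> limc(2) _ _ le])
         (use True Rp lims(2) in \<open>simp_all add: cos_coeff_def sin_coeff_def\<close>)
  next
    case False
    show ?thesis
    proof (rule divergent_perturbation_bound[OF W lims(1) limc(1) \<alpha> lims(2)])
      show "emeasure (gaussian 0 (mat 1 + outer (as m) (as m) + outer (ac m) (ac m)))
          {z. F_type_stat R 0 (beta_hat X) (Omega_W X R W) {} z \<ge> C}
        \<le> (SUP f\<in>FF. emeasure (gaussian \<mu> (\<sigma>2 *\<^sub>R Sigma_spec t f))
          {y. F_type_stat R r (beta_hat X) (Omega_W X R W) {} y \<ge> C})" for m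
        using le[of m] by (simp add: add_ac)
    qed (use False Rp limc(2) in \<open>simp_all add: cos_coeff_def sin_coeff_def\<close>)
  qed
qed

end

theorem corollary5p5:
  fixes X :: "real^'k^'n" and R :: "real^'k^'q" and r :: "real^'q"
    and W :: "real^'n^'n" and FF :: "(real \<Rightarrow> real) set"
    and t :: "'n \<Rightarrow> nat" and c :: "'k \<Rightarrow> nat" and kF :: nat
  assumes "CARD('k) < CARD('n)"
    and "rank X = CARD('k)" and "rank R = CARD('q)"
    and "bij_betw t UNIV {1..CARD('n)}" and "bij_betw c UNIV {1..CARD('k)}"
    and "F_AR2_ext \<subseteq> FF" and "FF \<subseteq> F_all"
    and "1 \<le> kF" and "kF \<le> CARD('k)"
    and "\<forall>i j. c j \<le> kF \<longrightarrow> X $ i $ j = real (t i) ^ (c j - 1)"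
    and "\<exists>i. c i \<le> kF \<and> column i R \<noteq> 0"
    and "transpose W = W"
    and "proj_matrix ((span (columns X))\<^sup>\<bottom>) ** W ** proj_matrix ((span (columns X))\<^sup>\<bottom>) \<noteq> 0"
  shows "estimator_conditions X (beta_hat X) (Omega_W X R W) {} \<and>
    (\<forall>C. \<forall>\<mu>0\<in>M0 X R r. \<forall>\<sigma>2>0.
       emeasure (gaussian 0 (mat 1)) {y. omega_hat X W y \<ge> 0}
         \<le> (SUP f\<in>FF. emeasure (gaussian \<mu>0 (\<sigma>2 *\<^sub>R Sigma_spec t f))
             {y. F_type_stat R r (beta_hat X) (Omega_W X R W) {} y \<ge> C})) \<and>
    (\<forall>C\<ge>0.
       (SUP \<mu>1\<in>M1 X R r. SUP \<sigma>2\<in>{0<..}.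
          emeasure (gaussian \<mu>1 (\<sigma>2 *\<^sub>R mat 1))
            {y. F_type_stat R r (beta_hat X) (Omega_W X R W) {} y \<ge> C})
         \<le> emeasure (gaussian 0 (mat 1)) {y. omega_hat X W y \<ge> 0})"
proof -
  interpret regression X R by unfold_locales (fact assms)+
  have W: "\<exists>v. omega_hat X W v \<noteq> 0" using assms by (intro omega_hat_nontrivial)
  have t: "inj t" using assms(4) by (rule bij_betw_imp_inj_on)
  \<comment> \<open>Column numbers start at one and powers at zero: the unit vector
    \<open>b i\<close> selects the column numbered \<open>Suc i\<close>, which carries the power
    \<open>i\<close>.\<close>
  define b :: "nat \<Rightarrow> real^'k" where "b i = axis (inv_into UNIV c (Suc i)) 1" for i
  have c: "c (inv_into UNIV c (Suc i)) = Suc i" if "i < kF" for i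
    using assms(5,9) that by (intro f_inv_into_f) (auto simp: bij_betw_def)
  have b: "X *v b i = (\<chi> l. real (t l) ^ i)" if "i < kF" for i
    using assms(10) c[OF that] that
    by (simp add: b_def matrix_vector_mult_basis column_def vec_eq_iff)
  obtain i where i: "c i \<le> kF" "column i R \<noteq> 0" using assms(11) by blast
  have "c i \<in> {1..CARD('k)}" using assms(5) by (auto simp: bij_betw_def)
  then obtain m where m: "c i = Suc m" by (cases "c i") auto
  have "inv_into UNIV c (Suc m) = i"
    using assms(5) m by (metis bij_betw_imp_inj_on inv_f_f)
  then have nz: "\<exists>i<kF. R *v b i \<noteq> 0"
    using i m by (intro exI[of _ m]) (simp add: b_def matrix_vector_mult_basis)
  show ?thesis
    using estimator_conditions_hold[OF W] null_bound[OF W t assms(6,7) _ _ b nz] alternative_bound[OF W]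
    by (auto intro!: SUP_least)
qed

end
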